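(* Let $(M,g)$ be an $n$-dimensional pseudo-Riemannian manifold, let $I\subseteq\mathbb R$ be an open connected interval, let $f\colon I\to(0,\infty)$ be smooth, and let $\bar M=I\times_f M$ be the $(n+1)$-dimensional generalized Robertson-Walker space-time with metric $\bar g=-\mathrm dt^2\oplus f^2g$. Suppose $\bar M$ is concircularly flat. Suppose that $\bar X=h\partial_t+X$ is a vector field on $\bar M$, where $X$ is a vector field on $M$ and $h$ is a smooth function on $I$. Then $(\bar M,\bar g)$ is flat if one of the following conditions holds: (1) $M$ admits a concircular vector field and $f$ is constant; or (2) $f(t)=at+b$ for constants $a,b$.
   Context: A generalized Robertson-Walker space-time $I\times_fM$ is the product $I\times M$ with metric $-\mathrm dt^2\oplus f(t)^2g$; $\partial_t$ denotes $\partial/\partial t$. With $\mathcal R(X,Y)Z=\nabla_Y\nabla_XZ-\nabla_X\nabla_YZ+\nabla_{[X,Y]}Z$, the concircular curvature tensor of an $m$-dimensional pseudo-Riemannian manifold ($m\ge 3$) with metric $g$ and scalar curvature $\tau$ is $\mathcal C(X,Y)Z=\mathcal R(X,Y)Z-\frac{\tau}{m(m-1)}[g(X,Z)Y-g(Y,Z)X]$; the manifold is concircularly flat if $\mathcal C=0$ and flat if $\mathcal R=0$. A vector field $\zeta$ is concircular if $\nabla_X\zeta=\varphi X$ for every vector field $X$, for some smooth function $\varphi$. (The vector field $\bar X$ is introduced in the hypotheses but does not occur in the conclusion.) *)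

theory Defs
  imports "HOL-Analysis.Analysis"
begin

section \<open>Smooth maps between Euclidean spaces\<close>

text \<open>Meant for open \<open>S\<close>: \<open>Ck_on k S F\<close> says that \<open>F\<close> is \<open>k\<close> times continuously differentiable
  on \<open>S\<close>, phrased via directional derivatives.\<close>

primrec Ck_on :: "nat \<Rightarrow> 'a::euclidean_space set \<Rightarrow> ('a \<Rightarrow> 'b::euclidean_space) \<Rightarrow> bool" where
  "Ck_on 0 S F \<longleftrightarrow> continuous_on S F"
| "Ck_on (Suc k) S F \<longleftrightarrow> (\<forall>x\<in>S. F differentiable (at x)) \<and>
     (\<forall>v. Ck_on k S (\<lambda>x. frechet_derivative F (at x) v))"

definition smooth_on :: "'a::euclidean_space set \<Rightarrow> ('a \<Rightarrow> 'b::euclidean_space) \<Rightarrow> bool" where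
  "smooth_on S F \<longleftrightarrow> (\<forall>k. Ck_on k S F)"

section \<open>Smooth manifolds\<close>

text \<open>A chart is a pair of an open set of points and a coordinate map on it. The model space
  \<open>'e\<close> fixes the dimension: a \<open>('m, 'e) manifold\<close> has dimension \<open>DIM('e)\<close>. The atlas need not be
  maximal; all notions below depend only on the smooth structure that it determines.\<close>

record ('m, 'e) manifold =
  mtop :: "'m topology"
  atlas :: "('m set \<times> ('m \<Rightarrow> 'e)) set"

abbreviation carrier_of :: "('m, 'e) manifold \<Rightarrow> 'm set" where
  "carrier_of M \<equiv> topspace (mtop M)"

definition smooth_manifold :: "('m, 'e::euclidean_space) manifold \<Rightarrow> bool" where
  "smooth_manifold M \<longleftrightarrow>
     Hausdorff_space (mtop M) \<and> second_countable (mtop M) \<and>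
     (\<Union>(U, c)\<in>atlas M. U) = carrier_of M \<and>
     (\<forall>(U, c)\<in>atlas M. openin (mtop M) U \<and> open (c ` U) \<and>
        homeomorphic_map (subtopology (mtop M) U) (top_of_set (c ` U)) c) \<and>
     (\<forall>(U, c)\<in>atlas M. \<forall>(V, d)\<in>atlas M. smooth_on (c ` (U \<inter> V)) (d \<circ> inv_into U c))"

definition smooth_fun :: "('m, 'e::euclidean_space) manifold \<Rightarrow> 'm set \<Rightarrow> ('m \<Rightarrow> real) \<Rightarrow> bool" where
  "smooth_fun M W \<phi> \<longleftrightarrow> (\<forall>(U, c)\<in>atlas M. smooth_on (c ` (U \<inter> W)) (\<phi> \<circ> inv_into U c))"

definition smooth_near :: "('m, 'e::euclidean_space) manifold \<Rightarrow> 'm \<Rightarrow> ('m \<Rightarrow> real) \<Rightarrow> bool" where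
  "smooth_near M p \<phi> \<longleftrightarrow> (\<exists>W. openin (mtop M) W \<and> p \<in> W \<and> smooth_fun M W \<phi>)"

section \<open>Tangent vectors and vector fields\<close>

text \<open>Tangent vectors at \<open>p\<close> are directional derivatives, acting on the functions that are smooth
  near \<open>p\<close>. By convention they are \<open>0\<close> on all other functions, so that equality of tangent
  vectors is equality of functionals.\<close>

type_synonym 'm tvec = "('m \<Rightarrow> real) \<Rightarrow> real"
type_synonym 'm vfield = "'m \<Rightarrow> 'm tvec"

definition coord_vec ::
  "('m, 'e::euclidean_space) manifold \<Rightarrow> 'm set \<Rightarrow> ('m \<Rightarrow> 'e) \<Rightarrow> 'm \<Rightarrow> 'e \<Rightarrow> 'm tvec" where
  "coord_vec M U c p u =
     (\<lambda>\<phi>. if smooth_near M p \<phi> then frechet_derivative (\<phi> \<circ> inv_into U c) (at (c p)) u else 0)"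

definition tangent_space :: "('m, 'e::euclidean_space) manifold \<Rightarrow> 'm \<Rightarrow> 'm tvec set" where
  "tangent_space M p = {coord_vec M U c p u | U c u. (U, c) \<in> atlas M \<and> p \<in> U}"

definition vadd :: "'m tvec \<Rightarrow> 'm tvec \<Rightarrow> 'm tvec" where
  "vadd v w = (\<lambda>\<phi>. v \<phi> + w \<phi>)"

definition vscale :: "real \<Rightarrow> 'm tvec \<Rightarrow> 'm tvec" where
  "vscale a v = (\<lambda>\<phi>. a * v \<phi>)"

definition vzero :: "'m tvec" where
  "vzero = (\<lambda>\<phi>. 0)"

text \<open>The differential of \<open>F\<close> at a point that \<open>F\<close> maps to the point \<open>p\<close> of \<open>M\<close>.\<close>

definition push_forward ::
  "('m, 'e::euclidean_space) manifold \<Rightarrow> 'm \<Rightarrow> ('k \<Rightarrow> 'm) \<Rightarrow> 'k tvec \<Rightarrow> 'm tvec" where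
  "push_forward M p F v = (\<lambda>\<phi>. if smooth_near M p \<phi> then v (\<phi> \<circ> F) else 0)"

text \<open>Smooth vector fields on an open subset \<open>W\<close> of \<open>M\<close>; the values outside \<open>W\<close> are irrelevant.
  Vector fields on \<open>M\<close> itself are the case \<open>W = carrier_of M\<close>.\<close>

definition vector_field :: "('m, 'e::euclidean_space) manifold \<Rightarrow> 'm set \<Rightarrow> 'm vfield \<Rightarrow> bool" where
  "vector_field M W X \<longleftrightarrow>
     (\<forall>p\<in>W. X p \<in> tangent_space M p) \<and>
     (\<forall>V \<phi>. openin (mtop M) V \<and> V \<subseteq> W \<and> smooth_fun M V \<phi> \<longrightarrow> smooth_fun M V (\<lambda>p. X p \<phi>))"

definition lie_bracket ::
  "('m, 'e::euclidean_space) manifold \<Rightarrow> 'm vfield \<Rightarrow> 'm vfield \<Rightarrow> 'm vfield" where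
  "lie_bracket M X Y = (\<lambda>p \<phi>. if smooth_near M p \<phi>
     then X p (\<lambda>q. Y q \<phi>) - Y p (\<lambda>q. X q \<phi>) else 0)"

section \<open>Pseudo-Riemannian metrics\<close>

text \<open>The index of \<open>g\<close> at \<open>p\<close> is the largest dimension of a subspace of the tangent space on which
  \<open>g\<close> is negative definite; vectors \<open>e 0, \<dots>, e (k - 1)\<close> as below are automatically independent.\<close>

definition metric_index ::
  "('m, 'e::euclidean_space) manifold \<Rightarrow> ('m \<Rightarrow> 'm tvec \<Rightarrow> 'm tvec \<Rightarrow> real) \<Rightarrow> 'm \<Rightarrow> nat" where
  "metric_index M g p = Max {k. \<exists>e :: nat \<Rightarrow> 'm tvec. (\<forall>i<k. e i \<in> tangent_space M p) \<and>
     (\<forall>a :: nat \<Rightarrow> real. (\<exists>i<k. a i \<noteq> 0) \<longrightarrow>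
        g p (\<lambda>\<phi>. \<Sum>i<k. a i * e i \<phi>) (\<lambda>\<phi>. \<Sum>i<k. a i * e i \<phi>) < 0)}"

definition pseudo_riemannian_metric ::
  "('m, 'e::euclidean_space) manifold \<Rightarrow> ('m \<Rightarrow> 'm tvec \<Rightarrow> 'm tvec \<Rightarrow> real) \<Rightarrow> bool" where
  "pseudo_riemannian_metric M g \<longleftrightarrow>
     (\<forall>p\<in>carrier_of M. \<forall>u\<in>tangent_space M p. \<forall>v\<in>tangent_space M p.
        g p u v = g p v u \<and>
        (\<forall>w\<in>tangent_space M p. \<forall>a b.
           g p (vadd (vscale a u) (vscale b v)) w = a * g p u w + b * g p v w)) \<and>
     (\<forall>p\<in>carrier_of M. \<forall>u\<in>tangent_space M p.
        (\<forall>v\<in>tangent_space M p. g p u v = 0) \<longrightarrow> u = vzero) \<and>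
     (\<exists>\<nu>. \<forall>p\<in>carrier_of M. metric_index M g p = \<nu>) \<and>
     (\<forall>W X Y. openin (mtop M) W \<and> vector_field M W X \<and> vector_field M W Y \<longrightarrow>
        smooth_fun M W (\<lambda>p. g p (X p) (Y p)))"

section \<open>The Levi-Civita connection\<close>

text \<open>A connection acts on vector fields over every open subset \<open>W\<close>. Compatibility with restriction
  is built in, since a vector field over \<open>W\<close> is also a vector field over each smaller open set.\<close>

definition connection ::
  "('m, 'e::euclidean_space) manifold \<Rightarrow> ('m vfield \<Rightarrow> 'm vfield \<Rightarrow> 'm vfield) \<Rightarrow> bool" where
  "connection M D \<longleftrightarrow> (\<forall>W. openin (mtop M) W \<longrightarrow>
     (\<forall>X Y. vector_field M W X \<and> vector_field M W Y \<longrightarrow> vector_field M W (D X Y)) \<and>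
     (\<forall>X X' Y a b. vector_field M W X \<and> vector_field M W X' \<and> vector_field M W Y \<and>
        smooth_fun M W a \<and> smooth_fun M W b \<longrightarrow>
        (\<forall>p\<in>W. D (\<lambda>q. vadd (vscale (a q) (X q)) (vscale (b q) (X' q))) Y p =
           vadd (vscale (a p) (D X Y p)) (vscale (b p) (D X' Y p)))) \<and>
     (\<forall>X Y Y'. vector_field M W X \<and> vector_field M W Y \<and> vector_field M W Y' \<longrightarrow>
        (\<forall>p\<in>W. D X (\<lambda>q. vadd (Y q) (Y' q)) p = vadd (D X Y p) (D X Y' p))) \<and>
     (\<forall>X Y a. vector_field M W X \<and> vector_field M W Y \<and> smooth_fun M W a \<longrightarrow>
        (\<forall>p\<in>W. D X (\<lambda>q. vscale (a q) (Y q)) p =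
           vadd (vscale (X p a) (Y p)) (vscale (a p) (D X Y p)))))"

definition levi_civita ::
  "('m, 'e::euclidean_space) manifold \<Rightarrow> ('m \<Rightarrow> 'm tvec \<Rightarrow> 'm tvec \<Rightarrow> real) \<Rightarrow>
     ('m vfield \<Rightarrow> 'm vfield \<Rightarrow> 'm vfield) \<Rightarrow> bool" where
  "levi_civita M g D \<longleftrightarrow> connection M D \<and>
     (\<forall>W X Y. openin (mtop M) W \<and> vector_field M W X \<and> vector_field M W Y \<longrightarrow>
        (\<forall>p\<in>W. D X Y p = vadd (D Y X p) (lie_bracket M X Y p))) \<and>
     (\<forall>W X Y Z. openin (mtop M) W \<and> vector_field M W X \<and> vector_field M W Y \<and>
        vector_field M W Z \<longrightarrow>
        (\<forall>p\<in>W. X p (\<lambda>q. g q (Y q) (Z q)) = g p (D X Y p) (Z p) + g p (Y p) (D X Z p)))"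

section \<open>Curvature\<close>

text \<open>Sign convention: \<open>R(X,Y)Z = D\<^sub>Y D\<^sub>X Z - D\<^sub>X D\<^sub>Y Z + D\<^bsub>[X,Y]\<^esub> Z\<close>.\<close>

definition curvature ::
  "('m, 'e::euclidean_space) manifold \<Rightarrow> ('m vfield \<Rightarrow> 'm vfield \<Rightarrow> 'm vfield) \<Rightarrow>
     'm vfield \<Rightarrow> 'm vfield \<Rightarrow> 'm vfield \<Rightarrow> 'm vfield" where
  "curvature M D X Y Z =
     (\<lambda>p \<phi>. D Y (D X Z) p \<phi> - D X (D Y Z) p \<phi> + D (lie_bracket M X Y) Z p \<phi>)"

definition orthonormal_frame ::
  "('m, 'e::euclidean_space) manifold \<Rightarrow> ('m \<Rightarrow> 'm tvec \<Rightarrow> 'm tvec \<Rightarrow> real) \<Rightarrow> 'm \<Rightarrow>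
     (nat \<Rightarrow> 'm vfield) \<Rightarrow> bool" where
  "orthonormal_frame M g p E \<longleftrightarrow>
     (\<exists>W. openin (mtop M) W \<and> p \<in> W \<and> (\<forall>i<DIM('e). vector_field M W (E i))) \<and>
     (\<forall>i<DIM('e). \<bar>g p (E i p) (E i p)\<bar> = 1) \<and>
     (\<forall>i<DIM('e). \<forall>j<DIM('e). i \<noteq> j \<longrightarrow> g p (E i p) (E j p) = 0)"

text \<open>\<open>Ric(X,Z)\<close> is the trace of \<open>V \<mapsto> R(X,V)Z\<close> and the scalar curvature is the metric trace of
  \<open>Ric\<close>, both computed in a frame that is orthonormal at \<open>p\<close>. As the curvature is tensorial,
  neither depends on the frame. With the above sign convention round spheres have positive
  scalar curvature.\<close>

definition ricci ::
  "('m, 'e::euclidean_space) manifold \<Rightarrow> ('m \<Rightarrow> 'm tvec \<Rightarrow> 'm tvec \<Rightarrow> real) \<Rightarrow>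
     ('m vfield \<Rightarrow> 'm vfield \<Rightarrow> 'm vfield) \<Rightarrow> (nat \<Rightarrow> 'm vfield) \<Rightarrow>
     'm vfield \<Rightarrow> 'm vfield \<Rightarrow> 'm \<Rightarrow> real" where
  "ricci M g D E X Z p =
     (\<Sum>j<DIM('e). g p (E j p) (E j p) * g p (curvature M D X (E j) Z p) (E j p))"

definition scalar_curvature ::
  "('m, 'e::euclidean_space) manifold \<Rightarrow> ('m \<Rightarrow> 'm tvec \<Rightarrow> 'm tvec \<Rightarrow> real) \<Rightarrow>
     ('m vfield \<Rightarrow> 'm vfield \<Rightarrow> 'm vfield) \<Rightarrow> 'm \<Rightarrow> real" where
  "scalar_curvature M g D p =
     (let E = (SOME E. orthonormal_frame M g p E) in
        \<Sum>i<DIM('e). g p (E i p) (E i p) * ricci M g D E (E i) (E i) p)"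

definition concircular_curvature ::
  "('m, 'e::euclidean_space) manifold \<Rightarrow> ('m \<Rightarrow> 'm tvec \<Rightarrow> 'm tvec \<Rightarrow> real) \<Rightarrow>
     ('m vfield \<Rightarrow> 'm vfield \<Rightarrow> 'm vfield) \<Rightarrow>
     'm vfield \<Rightarrow> 'm vfield \<Rightarrow> 'm vfield \<Rightarrow> 'm vfield" where
  "concircular_curvature M g D X Y Z =
     (\<lambda>p \<phi>. curvature M D X Y Z p \<phi> -
        scalar_curvature M g D p / (real DIM('e) * (real DIM('e) - 1)) *
        (g p (X p) (Z p) * Y p \<phi> - g p (Y p) (Z p) * X p \<phi>))"

text \<open>In the next three definitions \<open>D\<close> is the Levi-Civita connection of \<open>g\<close>, which exists and is
  unique on vector fields by the fundamental theorem of pseudo-Riemannian geometry. Requiring the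
  identities for local vector fields is equivalent to requiring them for global ones, because
  both sides are tensorial.\<close>

definition flat ::
  "('m, 'e::euclidean_space) manifold \<Rightarrow> ('m \<Rightarrow> 'm tvec \<Rightarrow> 'm tvec \<Rightarrow> real) \<Rightarrow> bool" where
  "flat M g \<longleftrightarrow> (\<exists>D. levi_civita M g D \<and>
     (\<forall>W X Y Z. openin (mtop M) W \<and> vector_field M W X \<and> vector_field M W Y \<and>
        vector_field M W Z \<longrightarrow> (\<forall>p\<in>W. curvature M D X Y Z p = vzero)))"

definition concircularly_flat ::
  "('m, 'e::euclidean_space) manifold \<Rightarrow> ('m \<Rightarrow> 'm tvec \<Rightarrow> 'm tvec \<Rightarrow> real) \<Rightarrow> bool" where
  "concircularly_flat M g \<longleftrightarrow> (\<exists>D. levi_civita M g D \<and>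
     (\<forall>W X Y Z. openin (mtop M) W \<and> vector_field M W X \<and> vector_field M W Y \<and>
        vector_field M W Z \<longrightarrow> (\<forall>p\<in>W. concircular_curvature M g D X Y Z p = vzero)))"

definition concircular_field ::
  "('m, 'e::euclidean_space) manifold \<Rightarrow> ('m \<Rightarrow> 'm tvec \<Rightarrow> 'm tvec \<Rightarrow> real) \<Rightarrow>
     'm vfield \<Rightarrow> bool" where
  "concircular_field M g \<zeta> \<longleftrightarrow> vector_field M (carrier_of M) \<zeta> \<and>
     (\<exists>D \<phi>. levi_civita M g D \<and> smooth_fun M (carrier_of M) \<phi> \<and>
       (\<forall>W X. openin (mtop M) W \<and> vector_field M W X \<longrightarrow>
          (\<forall>p\<in>W. D X \<zeta> p = vscale (\<phi> p) (X p))))"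

section \<open>Generalized Robertson-Walker space-times\<close>

definition product_manifold ::
  "real set \<Rightarrow> ('m, 'e::euclidean_space) manifold \<Rightarrow> (real \<times> 'm, real \<times> 'e) manifold" where
  "product_manifold I M =
     \<lparr> mtop = prod_topology (top_of_set I) (mtop M),
       atlas = {(I \<times> U, \<lambda>(t, p). (t, c p)) | U c. (U, c) \<in> atlas M} \<rparr>"

text \<open>The metric \<open>-dt\<^sup>2 \<oplus> f\<^sup>2 g\<close>: the \<open>dt\<close>-component of a tangent vector \<open>v\<close> is \<open>v\<close> applied to the
  coordinate function \<open>t\<close>, i.e. to \<open>fst\<close>; its \<open>M\<close>-component is its image under the differential
  of the projection \<open>snd\<close>.\<close>

definition grw_metric ::
  "('m, 'e::euclidean_space) manifold \<Rightarrow> (real \<Rightarrow> real) \<Rightarrow>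
     ('m \<Rightarrow> 'm tvec \<Rightarrow> 'm tvec \<Rightarrow> real) \<Rightarrow>
     real \<times> 'm \<Rightarrow> (real \<times> 'm) tvec \<Rightarrow> (real \<times> 'm) tvec \<Rightarrow> real" where
  "grw_metric M f g = (\<lambda>(t, p) v w.
     - (v fst * w fst) + (f t)\<^sup>2 * g p (push_forward M p snd v) (push_forward M p snd w))"

definition partial_t ::
  "real set \<Rightarrow> ('m, 'e::euclidean_space) manifold \<Rightarrow> (real \<times> 'm) vfield" where
  "partial_t I M = (\<lambda>(t, p) \<phi>. if smooth_near (product_manifold I M) (t, p) \<phi>
     then deriv (\<lambda>s. \<phi> (s, p)) t else 0)"

text \<open>The lift of a vector field on \<open>M\<close>, tangent to the slices \<open>{t} \<times> M\<close>.\<close>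

definition lift_field ::
  "real set \<Rightarrow> ('m, 'e::euclidean_space) manifold \<Rightarrow> 'm vfield \<Rightarrow> (real \<times> 'm) vfield" where
  "lift_field I M X =
     (\<lambda>(t, p). push_forward (product_manifold I M) (t, p) (Pair t) (X p))"

end

(* For f(t) = a t + b we have f'' = 0, and f'' is what governs the curvature in the planes that
   contain d/dt. Write T = d/dt and let V, V' be coordinate fields of M. Metric compatibility and
   vanishing torsion give <D_T T, _> = 0, <D_V T, V'> = a f g(V, V') and
   <D_V T, D_V' T> = a^2 g(V, V'), so <R(T,V)T, V'> = a^2 g(V, V') - a^2 g(V, V') = 0. Concircular
   flatness makes R(T,V)T = - k V with k = tau / (m (m - 1)), so k = 0 at every point, and then
   R = 0. Only these pairings are needed, so neither the nondegeneracy of the warped metric nor the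
   connection of M enters. *)

theory Submission
  imports Defs
begin

text \<open>The covariant derivatives of coordinate fields can be compared because their brackets
  vanish, which rests on equality of mixed partial derivatives; the calculus from
  \<open>Ck_on\<close> upwards is built for that. Moreover, tangent vectors are functionals that are
  0 by convention on germs that are not smooth, so every evaluation comes with a proof of
  smoothness. Both second covariant derivatives in \<open>R(T,V)T\<close> are reached by
  differentiating a pairing: \<open><D_V D_T T, V'> = V<D_T T, V'> - <D_T T, D_V V'>\<close> is 0
  term by term, and \<open><D_T D_V T, V'> = T(a f g(V,V')) - <D_V T, D_V' T>\<close> cancels
  because \<open>f' = a\<close>. The scalar curvature, defined through a chosen frame, is never
  evaluated: at each point a single factor governs all of \<open>R\<close>, so one plane determines
  it. A constant \<open>f\<close> is the affine case of slope 0.\<close>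

section \<open>Calculus of smooth maps\<close>

text \<open>On an open set a derivative sees only nearby values, so functions that agree on
  \<open>S\<close> have the same directional derivatives there, and the induction passes to
  these.\<close>

lemma Ck_on_cong:
  assumes "open S" "\<And>x. x \<in> S \<Longrightarrow> F x = G x"
  shows "Ck_on k S F \<longleftrightarrow> Ck_on k S G"
  using assms
proof (induction k arbitrary: F G)
  case 0
  then show ?case by (simp cong: continuous_on_cong)
next
  case (Suc k)
  have d: "F differentiable (at x) \<longleftrightarrow> G differentiable (at x)" if "x \<in> S" for x
    using Suc.prems that unfolding differentiable_def
    by (metis has_derivative_transform_within_open)
  have e: "frechet_derivative F (at x) = frechet_derivative G (at x)" if "x \<in> S" for x
  proof -
    \<comment> \<open>\<open>frechet_derivative\<close> is a choice operator, so the two choices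
      agree once the predicates chosen from are equivalent for every \<open>D\<close>.\<close>
    have "(F has_derivative D) (at x) \<longleftrightarrow> (G has_derivative D) (at x)" for D
      using Suc.prems that by (metis has_derivative_transform_within_open)
    then show ?thesis
      unfolding frechet_derivative_def by simp
  qed
  have "Ck_on k S (\<lambda>x. frechet_derivative F (at x) v) \<longleftrightarrow>
      Ck_on k S (\<lambda>x. frechet_derivative G (at x) v)" for v
    using Suc.prems(1) by (intro Suc.IH) (auto simp: e)
  then show ?case
    using d by simp
qed

lemma Ck_on_subset: "Ck_on k S F \<Longrightarrow> T \<subseteq> S \<Longrightarrow> Ck_on k T F"
  by (induction k arbitrary: F) (auto intro: continuous_on_subset)

lemma Ck_on_Suc_imp: "Ck_on (Suc k) S F \<Longrightarrow> Ck_on k S F"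
proof (induction k arbitrary: F)
  case 0
  then show ?case
    by (auto intro!: continuous_at_imp_continuous_on differentiable_imp_continuous_within)
next
  case (Suc k)
  then show ?case
    using Ck_on.simps(2) by blast
qed

lemma Ck_on_const: "Ck_on k S (\<lambda>x. a)"
  by (induction k arbitrary: a) auto

text \<open>Introduction rule for the closure properties: a derivative known in closed form replaces
  \<open>frechet_derivative\<close> by congruence on the open set.\<close>

lemma Ck_on_has_derivative:
  assumes "open S" "\<And>x. x \<in> S \<Longrightarrow> (F has_derivative D x) (at x)"
    and "\<And>v. Ck_on k S (\<lambda>x. D x v)"
  shows "Ck_on (Suc k) S F"
proof -
  have e: "frechet_derivative F (at x) = D x" if "x \<in> S" for x
    using assms(2)[OF that] frechet_derivative_at by metis
  have "Ck_on k S (\<lambda>x. frechet_derivative F (at x) v)" for v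
    using assms(3)[of v] Ck_on_cong[OF assms(1), of "\<lambda>x. frechet_derivative F (at x) v" "\<lambda>x. D x v"]
    by (simp add: e)
  then show ?thesis
    using assms(2) by (auto simp: differentiable_def)
qed

lemma Ck_on_SucD:
  assumes "Ck_on (Suc k) S F"
  shows "x \<in> S \<Longrightarrow> (F has_derivative frechet_derivative F (at x)) (at x)"
    and "Ck_on k S (\<lambda>x. frechet_derivative F (at x) v)"
  using assms by (auto simp: frechet_derivative_works)

lemma Ck_on_linear:
  assumes "bounded_linear L" "open S" "Ck_on k S F"
  shows "Ck_on k S (\<lambda>x. L (F x))"
  using assms(3)
proof (induction k arbitrary: F)
  case 0
  then show ?case
    using assms(1) by (auto intro: bounded_linear.continuous_on)
next
  case (Suc k)
  show ?case
    by (rule Ck_on_has_derivative[OF assms(2)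
          bounded_linear.has_derivative[OF assms(1) Ck_on_SucD(1)[OF Suc.prems]]
          Suc.IH[OF Ck_on_SucD(2)[OF Suc.prems]]])
qed

section \<open>Closure of smoothness under sums, products and composition\<close>

lemma Ck_on_add:
  assumes "open S" "Ck_on k S F" "Ck_on k S G"
  shows "Ck_on k S (\<lambda>x. F x + G x)"
  using assms(2,3)
proof (induction k arbitrary: F G)
  case 0
  then show ?case
    by (auto intro: continuous_on_add)
next
  case (Suc k)
  show ?case
    by (rule Ck_on_has_derivative[OF assms(1)
          has_derivative_add[OF Ck_on_SucD(1)[OF Suc.prems(1)] Ck_on_SucD(1)[OF Suc.prems(2)]]
          Suc.IH[OF Ck_on_SucD(2)[OF Suc.prems(1)] Ck_on_SucD(2)[OF Suc.prems(2)]]])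
qed

lemma Ck_on_sum:
  assumes "open S" "\<And>i. i \<in> B \<Longrightarrow> Ck_on k S (F i)"
  shows "Ck_on k S (\<lambda>x. \<Sum>i\<in>B. F i x)"
  using assms(2)
  by (induction B rule: infinite_finite_induct) (auto intro: Ck_on_const Ck_on_add[OF assms(1)])

text \<open>Each term of the product rule keeps one factor undifferentiated; that factor enters only
  to order \<open>k\<close>, hence \<open>Ck_on_Suc_imp\<close>.\<close>

lemma Ck_on_scaleR:
  assumes "open S" "Ck_on k S F" "Ck_on k S G"
  shows "Ck_on k S (\<lambda>x. F x *\<^sub>R G x)"
  using assms(2,3)
proof (induction k arbitrary: F G)
  case 0
  then show ?case
    by (auto intro: continuous_on_scaleR)
next
  case (Suc k)
  show ?case
    by (rule Ck_on_has_derivative[OF assms(1)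
          has_derivative_scaleR[OF Ck_on_SucD(1)[OF Suc.prems(1)] Ck_on_SucD(1)[OF Suc.prems(2)]]
          Ck_on_add[OF assms(1)
            Suc.IH[OF Ck_on_Suc_imp[OF Suc.prems(1)] Ck_on_SucD(2)[OF Suc.prems(2)]]
            Suc.IH[OF Ck_on_SucD(2)[OF Suc.prems(1)] Ck_on_Suc_imp[OF Suc.prems(2)]]]])
qed

lemma Ck_on_compose:
  fixes F :: "'a::euclidean_space \<Rightarrow> 'b::euclidean_space"
  assumes "open S" "open T" "F ` S \<subseteq> T" "Ck_on k S F" "Ck_on k T G"
  shows "Ck_on k S (\<lambda>x. G (F x))"
  using assms(4,5)
proof (induction k arbitrary: G)
  case 0
  then show ?case
    using assms(3) by (auto intro: continuous_on_compose2)
next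
  case (Suc k)
  let ?F = "\<lambda>x. frechet_derivative F (at x)" and ?G = "\<lambda>y. frechet_derivative G (at y)"
  \<comment> \<open>In the plain chain rule the direction fed to the derivative of \<open>G\<close>
    varies with \<open>x\<close>. Expanding it in the basis leaves fixed directions
    \<open>b\<close>, so that the induction hypothesis applies to the directional derivative of
    \<open>G\<close> along \<open>b\<close>.\<close>
  have d: "((\<lambda>x. G (F x)) has_derivative (\<lambda>v. \<Sum>b\<in>Basis. (?F x v \<bullet> b) *\<^sub>R ?G (F x) b)) (at x)"
    if x: "x \<in> S" for x
  proof -
    have Fx: "F x \<in> T"
      using x assms(3) by auto
    have "?G (F x) (?F x v) = (\<Sum>b\<in>Basis. (?F x v \<bullet> b) *\<^sub>R ?G (F x) b)" for v
      using linear_sum[of "?G (F x)"] linear_scale[of "?G (F x)"] euclidean_representation[of "?F x v"]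
        has_derivative_linear[OF Ck_on_SucD(1)[OF Suc.prems(2) Fx]]
      by (metis (no_types, lifting) sum.cong)
    then show ?thesis
      using has_derivative_compose[OF Ck_on_SucD(1)[OF Suc.prems(1) x] Ck_on_SucD(1)[OF Suc.prems(2) Fx]]
      by simp
  qed
  show ?case
  proof (rule Ck_on_has_derivative[OF assms(1) d])
    fix v
    show "Ck_on k S (\<lambda>x. \<Sum>b\<in>Basis. (?F x v \<bullet> b) *\<^sub>R ?G (F x) b)"
      by (intro Ck_on_sum Ck_on_scaleR assms(1) Ck_on_linear[OF bounded_linear_inner_left]
          Ck_on_SucD(2)[OF Suc.prems(1)] Suc.IH Ck_on_Suc_imp[OF Suc.prems(1)]
          Ck_on_SucD(2)[OF Suc.prems(2)])
  qed
qed

lemma Ck_on_ident: "open S \<Longrightarrow> Ck_on k S (\<lambda>x. x)"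
proof (cases k)
  case (Suc j)
  then show "open S \<Longrightarrow> Ck_on k S (\<lambda>x. x)"
    by (auto intro: Ck_on_const)
qed auto

lemma smooth_on_cong:
  "open S \<Longrightarrow> (\<And>x. x \<in> S \<Longrightarrow> F x = G x) \<Longrightarrow> smooth_on S F \<longleftrightarrow> smooth_on S G"
  unfolding smooth_on_def using Ck_on_cong by blast

lemma smooth_on_subset: "smooth_on S F \<Longrightarrow> T \<subseteq> S \<Longrightarrow> smooth_on T F"
  unfolding smooth_on_def using Ck_on_subset by blast

lemma smooth_on_const: "smooth_on S (\<lambda>x. a)"
  by (simp add: smooth_on_def Ck_on_const)

lemma smooth_on_ident: "open S \<Longrightarrow> smooth_on S (\<lambda>x. x)"
  by (simp add: smooth_on_def Ck_on_ident)

lemma smooth_on_linear: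
  "bounded_linear L \<Longrightarrow> open S \<Longrightarrow> smooth_on S F \<Longrightarrow> smooth_on S (\<lambda>x. L (F x))"
  by (simp add: smooth_on_def Ck_on_linear)

lemma smooth_on_add:
  "open S \<Longrightarrow> smooth_on S F \<Longrightarrow> smooth_on S G \<Longrightarrow> smooth_on S (\<lambda>x. F x + G x)"
  by (simp add: smooth_on_def Ck_on_add)

lemma smooth_on_mult:
  fixes F G :: "'a::euclidean_space \<Rightarrow> real"
  shows "open S \<Longrightarrow> smooth_on S F \<Longrightarrow> smooth_on S G \<Longrightarrow> smooth_on S (\<lambda>x. F x * G x)"
  using Ck_on_scaleR[of S _ F G] by (simp add: smooth_on_def)

lemma smooth_on_compose:
  "open S \<Longrightarrow> open T \<Longrightarrow> F ` S \<subseteq> T \<Longrightarrow> smooth_on S F \<Longrightarrow> smooth_on T G \<Longrightarrow> smooth_on S (\<lambda>x. G (F x))"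
  using Ck_on_compose by (metis smooth_on_def)

lemma smooth_on_Pair:
  assumes "open S" "smooth_on S F" "smooth_on S G"
  shows "smooth_on S (\<lambda>x. (F x, G x))"
proof -
  have "smooth_on S (\<lambda>x. (F x, 0) + (0, G x))"
    by (intro smooth_on_add assms(1) smooth_on_linear[OF _ _ assms(2)] smooth_on_linear[OF _ _ assms(3)]
        bounded_linear_Pair bounded_linear_ident bounded_linear_zero)
  then show ?thesis
    by simp
qed

lemma smooth_on_differentiable: "smooth_on S F \<Longrightarrow> x \<in> S \<Longrightarrow> F differentiable (at x)"
  unfolding smooth_on_def by (metis Ck_on.simps(2))

lemma smooth_on_derivative: "smooth_on S F \<Longrightarrow> smooth_on S (\<lambda>x. frechet_derivative F (at x) v)"
  unfolding smooth_on_def by (metis Ck_on.simps(2))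

lemma has_field_derivative_line:
  fixes F :: "'a::euclidean_space \<Rightarrow> real"
  assumes "(F has_derivative D) (at (x + \<alpha> *\<^sub>R u))"
  shows "((\<lambda>\<alpha>. F (x + \<alpha> *\<^sub>R u)) has_field_derivative D u) (at \<alpha>)"
proof -
  have "((\<lambda>\<alpha>. x + \<alpha> *\<^sub>R u) has_derivative (\<lambda>r. r *\<^sub>R u)) (at \<alpha>)"
    by (auto intro!: derivative_eq_intros)
  from has_derivative_compose[OF this assms]
  have "((\<lambda>\<alpha>. F (x + \<alpha> *\<^sub>R u)) has_derivative (\<lambda>r. D (r *\<^sub>R u))) (at \<alpha>)" .
  moreover have "D (r *\<^sub>R u) = D u * r" for r
    using linear_scale[OF has_derivative_linear[OF assms], of r u] by simp
  ultimately show ?thesis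
    by (simp add: has_field_derivative_def)
qed

text \<open>Symmetry of mixed second derivatives: the second difference
  \<open>F (x + s u + s v) - F (x + s u) - F (x + s v) + F x\<close> divided by \<open>s\<^sup>2\<close> tends to both.\<close>

lemma second_difference_mvt:
  fixes F :: "'a::euclidean_space \<Rightarrow> real"
  assumes "smooth_on S F" "s > 0"
    and inS: "\<And>\<alpha> \<beta>. \<alpha> \<in> {0..s} \<Longrightarrow> \<beta> \<in> {0..s} \<Longrightarrow> x + \<alpha> *\<^sub>R u + \<beta> *\<^sub>R v \<in> S"
  shows "\<exists>\<alpha>\<in>{0..s}. \<exists>\<beta>\<in>{0..s}.
      F (x + s *\<^sub>R u + s *\<^sub>R v) - F (x + s *\<^sub>R u) - F (x + s *\<^sub>R v) + F x =
      s\<^sup>2 * frechet_derivative (\<lambda>y. frechet_derivative F (at y) u) (at (x + \<alpha> *\<^sub>R u + \<beta> *\<^sub>R v)) v"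
proof -
  define G where "G = (\<lambda>y. frechet_derivative F (at y) u)"
  have dF: "(F has_derivative frechet_derivative F (at y)) (at y)" if "y \<in> S" for y
    using assms(1) that smooth_on_differentiable frechet_derivative_works by blast
  have dG: "(G has_derivative frechet_derivative G (at y)) (at y)" if "y \<in> S" for y
    using smooth_on_derivative[OF assms(1)] that smooth_on_differentiable frechet_derivative_works
    unfolding G_def by blast
  \<comment> \<open>The second difference is the increment over \<open>[0, s]\<close> of the
    function differentiated here; the mean value theorem turns it into \<open>s\<close> times a
    difference of \<open>G\<close> in direction \<open>v\<close>.\<close>
  have "((\<lambda>\<alpha>. F (x + \<alpha> *\<^sub>R u + s *\<^sub>R v) - F (x + \<alpha> *\<^sub>R u)) has_field_derivative
      (G (x + \<alpha> *\<^sub>R u + s *\<^sub>R v) - G (x + \<alpha> *\<^sub>R u))) (at \<alpha>)"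
    if "0 \<le> \<alpha>" "\<alpha> \<le> s" for \<alpha>
  proof -
    have i: "x + \<alpha> *\<^sub>R u + s *\<^sub>R v \<in> S" "x + \<alpha> *\<^sub>R u \<in> S"
      using inS[of \<alpha> s] inS[of \<alpha> 0] that assms(2) by auto
    show ?thesis
      using DERIV_diff[OF has_field_derivative_line[of F _ "x + s *\<^sub>R v" \<alpha> u] has_field_derivative_line[OF dF[OF i(2)]]]
        dF[OF i(1)] unfolding G_def by (simp add: ac_simps)
  qed
  then obtain \<alpha> where \<alpha>: "0 < \<alpha>" "\<alpha> < s"
    "F (x + s *\<^sub>R u + s *\<^sub>R v) - F (x + s *\<^sub>R u) - (F (x + 0 *\<^sub>R u + s *\<^sub>R v) - F (x + 0 *\<^sub>R u)) =
      (s - 0) * (G (x + \<alpha> *\<^sub>R u + s *\<^sub>R v) - G (x + \<alpha> *\<^sub>R u))"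
    using MVT2[OF assms(2), of "\<lambda>\<alpha>. F (x + \<alpha> *\<^sub>R u + s *\<^sub>R v) - F (x + \<alpha> *\<^sub>R u)"
        "\<lambda>\<alpha>. G (x + \<alpha> *\<^sub>R u + s *\<^sub>R v) - G (x + \<alpha> *\<^sub>R u)"] by auto
  \<comment> \<open>A second mean value theorem, now along \<open>v\<close>, yields the other factor
    \<open>s\<close>.\<close>
  have "((\<lambda>\<beta>. G (x + \<alpha> *\<^sub>R u + \<beta> *\<^sub>R v)) has_field_derivative
      (frechet_derivative G (at (x + \<alpha> *\<^sub>R u + \<beta> *\<^sub>R v)) v)) (at \<beta>)"
    if "0 \<le> \<beta>" "\<beta> \<le> s" for \<beta>
  proof -
    have i: "x + \<alpha> *\<^sub>R u + \<beta> *\<^sub>R v \<in> S"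
      using inS \<alpha> that by auto
    show ?thesis
      by (rule has_field_derivative_line[OF dG[OF i]])
  qed
  then obtain \<beta> where "0 < \<beta>" "\<beta> < s"
    "G (x + \<alpha> *\<^sub>R u + s *\<^sub>R v) - G (x + \<alpha> *\<^sub>R u + 0 *\<^sub>R v) =
      (s - 0) * frechet_derivative G (at (x + \<alpha> *\<^sub>R u + \<beta> *\<^sub>R v)) v"
    using MVT2[OF assms(2), of "\<lambda>\<beta>. G (x + \<alpha> *\<^sub>R u + \<beta> *\<^sub>R v)"
        "\<lambda>\<beta>. frechet_derivative G (at (x + \<alpha> *\<^sub>R u + \<beta> *\<^sub>R v)) v"] by auto
  with \<alpha> show ?thesis
    unfolding G_def[symmetric]
    by (intro bexI[of _ \<alpha>] bexI[of _ \<beta>]) (auto simp: power2_eq_square)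
qed

lemma second_derivative_symmetric:
  fixes F :: "'a::euclidean_space \<Rightarrow> real"
  assumes "open S" "smooth_on S F" "x \<in> S"
  shows "frechet_derivative (\<lambda>y. frechet_derivative F (at y) u) (at x) v =
    frechet_derivative (\<lambda>y. frechet_derivative F (at y) v) (at x) u"
proof -
  define H where "H u v y = frechet_derivative (\<lambda>y. frechet_derivative F (at y) u) (at y) v" for u v y
  have cont: "isCont (H u v) x" for u v
  proof -
    have "smooth_on S (H u v)"
      unfolding H_def by (intro smooth_on_derivative assms(2))
    then show ?thesis
      using assms(3) smooth_on_differentiable differentiable_imp_continuous_within by blast
  qed
  \<comment> \<open>The second difference is symmetric in \<open>u\<close> and \<open>v\<close>, so
    \<open>H u v\<close> and \<open>H v u\<close> take a common value at two points close to
    \<open>x\<close>; continuity costs one \<epsilon> for each.\<close>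
  have "\<bar>H u v x - H v u x\<bar> < \<epsilon> + \<epsilon>" if "\<epsilon> > 0" for \<epsilon>
  proof -
    have near: "\<forall>\<^sub>F y in nhds x. dist (H u v y) (H u v x) < \<epsilon>" for u v
    proof -
      have "filterlim (H u v) (nhds (H u v x)) (nhds x)"
        using cont[of u v] by (simp add: isCont_def tendsto_at_iff_tendsto_nhds)
      then show ?thesis
        using that by (simp add: tendsto_iff)
    qed
    have "\<forall>\<^sub>F y in nhds x. y \<in> S \<and> dist (H u v y) (H u v x) < \<epsilon> \<and> dist (H v u y) (H v u x) < \<epsilon>"
      using assms(1,3) by (intro eventually_conj eventually_nhds_in_open near)
    then obtain d where d: "d > 0" "\<And>y. dist y x < d \<Longrightarrow>
        y \<in> S \<and> dist (H u v y) (H u v x) < \<epsilon> \<and> dist (H v u y) (H v u x) < \<epsilon>"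
      by (auto simp: eventually_nhds_metric)
    \<comment> \<open>Small enough for the parallelogram spanned by \<open>s u\<close> and
      \<open>s v\<close> to stay within distance \<open>d\<close> of \<open>x\<close>. The summand 1
      covers \<open>u = v = 0\<close> and makes the bound strict.\<close>
    define s where "s = d / (norm u + norm v + 1)"
    have pos: "norm u + norm v + 1 > 0"
      by (smt (verit) norm_ge_zero)
    have s: "s > 0"
      using d pos by (simp add: s_def)
    have near: "dist (x + \<alpha> *\<^sub>R u + \<beta> *\<^sub>R v) x < d" if "\<alpha> \<in> {0..s}" "\<beta> \<in> {0..s}" for \<alpha> \<beta>
    proof -
      have "norm (\<alpha> *\<^sub>R u + \<beta> *\<^sub>R v) \<le> norm (\<alpha> *\<^sub>R u) + norm (\<beta> *\<^sub>R v)"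
        by (rule norm_triangle_ineq)
      also have "\<dots> \<le> s * norm u + s * norm v"
        using that s by (intro add_mono) (auto intro!: mult_right_mono)
      also have "\<dots> < s * (norm u + norm v + 1)"
        using s by (simp add: algebra_simps)
      also have "\<dots> = d"
        using pos by (simp add: s_def)
      finally show ?thesis
        by (simp add: dist_norm add.assoc)
    qed
    obtain \<alpha> \<beta> where 1: "\<alpha> \<in> {0..s}" "\<beta> \<in> {0..s}"
      "F (x + s *\<^sub>R u + s *\<^sub>R v) - F (x + s *\<^sub>R u) - F (x + s *\<^sub>R v) + F x =
        s\<^sup>2 * H u v (x + \<alpha> *\<^sub>R u + \<beta> *\<^sub>R v)"
      using second_difference_mvt[OF assms(2) s, of x u v] near d unfolding H_def by blast
    have near': "dist (x + \<alpha> *\<^sub>R v + \<beta> *\<^sub>R u) x < d" if "\<alpha> \<in> {0..s}" "\<beta> \<in> {0..s}" for \<alpha> \<beta>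
      using near[OF that(2,1)] by (simp add: ac_simps)
    obtain \<alpha>' \<beta>' where 2: "\<alpha>' \<in> {0..s}" "\<beta>' \<in> {0..s}"
      "F (x + s *\<^sub>R v + s *\<^sub>R u) - F (x + s *\<^sub>R v) - F (x + s *\<^sub>R u) + F x =
        s\<^sup>2 * H v u (x + \<alpha>' *\<^sub>R v + \<beta>' *\<^sub>R u)"
      using second_difference_mvt[OF assms(2) s, of x v u] near' d unfolding H_def by blast
    have "x + s *\<^sub>R v + s *\<^sub>R u = x + s *\<^sub>R u + s *\<^sub>R v"
      by simp
    from 1(3) 2(3)[unfolded this] have "s\<^sup>2 * H u v (x + \<alpha> *\<^sub>R u + \<beta> *\<^sub>R v) = s\<^sup>2 * H v u (x + \<alpha>' *\<^sub>R v + \<beta>' *\<^sub>R u)"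
      by linarith
    then have "H u v (x + \<alpha> *\<^sub>R u + \<beta> *\<^sub>R v) = H v u (x + \<alpha>' *\<^sub>R v + \<beta>' *\<^sub>R u)"
      using s by simp
    then show ?thesis
      using d(2)[OF near[OF 1(1,2)]] d(2)[OF near'[OF 2(1,2)]] by (auto simp: dist_real_def)
  qed
  \<comment> \<open>With half the difference as \<epsilon>, a nonzero difference would be smaller
    than itself.\<close>
  from this[of "\<bar>H u v x - H v u x\<bar> / 2"] have "H u v x = H v u x"
    by fastforce
  then show ?thesis
    by (simp add: H_def)
qed

section \<open>Coordinate vector fields\<close>

text \<open>The properties of charts on which the calculus runs, isolated so that the product with
  \<open>I\<close> can be made a second instance.\<close>

locale smooth_atlas =
  fixes M :: "('m, 'e::euclidean_space) manifold"
  assumes chart_open: "(U, c) \<in> atlas M \<Longrightarrow> openin (mtop M) U"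
    and chart_inj: "(U, c) \<in> atlas M \<Longrightarrow> inj_on c U"
    and chart_image_open:
      "(U, c) \<in> atlas M \<Longrightarrow> openin (mtop M) W \<Longrightarrow> W \<subseteq> U \<Longrightarrow> open (c ` W)"
    and chart_exists: "p \<in> carrier_of M \<Longrightarrow> \<exists>U c. (U, c) \<in> atlas M \<and> p \<in> U"
    and transition_smooth:
      "(U, c) \<in> atlas M \<Longrightarrow> (V, d) \<in> atlas M \<Longrightarrow> smooth_on (c ` (U \<inter> V)) (d \<circ> inv_into U c)"

lemma smooth_manifold_imp_smooth_atlas:
  assumes "smooth_manifold M"
  shows "smooth_atlas M"
proof
  fix U c
  assume U: "(U, c) \<in> atlas M"
  then have *: "openin (mtop M) U" "open (c ` U)"
    "homeomorphic_map (subtopology (mtop M) U) (top_of_set (c ` U)) c"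
    using assms by (auto simp: smooth_manifold_def)
  show "openin (mtop M) U"
    by fact
  have "topspace (subtopology (mtop M) U) = U"
    using openin_subset[OF *(1)] by (rule topspace_subtopology_subset)
  then show "inj_on c U"
    using *(3) homeomorphic_imp_injective_map by metis
  show "open (c ` W)" if "openin (mtop M) W" "W \<subseteq> U" for W
  proof -
    have "openin (subtopology (mtop M) U) W"
      using that * by (simp add: openin_open_subtopology)
    then have "openin (top_of_set (c ` U)) (c ` W)"
      using *(3) homeomorphic_imp_open_map open_map_def by blast
    then show ?thesis
      using *(2) openin_open_trans by blast
  qed
  show "smooth_on (c ` (U \<inter> V)) (d \<circ> inv_into U c)" if "(V, d) \<in> atlas M" for V d
    using assms U that unfolding smooth_manifold_def by fast
next
  fix p
  assume "p \<in> carrier_of M"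
  then have "p \<in> (\<Union>(U, c)\<in>atlas M. U)"
    using assms by (simp add: smooth_manifold_def)
  then show "\<exists>U c. (U, c) \<in> atlas M \<and> p \<in> U"
    by auto
qed

context smooth_atlas
begin

lemma chart_inv [simp]: "(U, c) \<in> atlas M \<Longrightarrow> p \<in> U \<Longrightarrow> inv_into U c (c p) = p"
  using chart_inj by (metis inv_into_f_f)

lemma chart_image_open_Int:
  "(U, c) \<in> atlas M \<Longrightarrow> openin (mtop M) W \<Longrightarrow> open (c ` (U \<inter> W))"
  using chart_image_open[of U c "U \<inter> W"] chart_open by auto

section \<open>Smooth functions and germs in charts\<close>

lemma smooth_fun_subset: "smooth_fun M W \<phi> \<Longrightarrow> V \<subseteq> W \<Longrightarrow> smooth_fun M V \<phi>"
  unfolding smooth_fun_def by (blast intro: smooth_on_subset)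

lemma smooth_fun_cong:
  assumes "openin (mtop M) W" "\<And>q. q \<in> W \<Longrightarrow> \<phi> q = \<psi> q"
  shows "smooth_fun M W \<phi> \<longleftrightarrow> smooth_fun M W \<psi>"
proof -
  have "smooth_on (c ` (U \<inter> W)) (\<phi> \<circ> inv_into U c) \<longleftrightarrow>
      smooth_on (c ` (U \<inter> W)) (\<psi> \<circ> inv_into U c)" if "(U, c) \<in> atlas M" for U c
    using that assms by (intro smooth_on_cong chart_image_open_Int) auto
  then show ?thesis
    unfolding smooth_fun_def by fast
qed

text \<open>One chart suffices: the expression in any other chart is this one composed with a
  transition map.\<close>

lemma smooth_fun_chartI:
  assumes "(U, c) \<in> atlas M" "openin (mtop M) W" "W \<subseteq> U" "smooth_on (c ` W) (\<phi> \<circ> inv_into U c)"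
  shows "smooth_fun M W \<phi>"
  unfolding smooth_fun_def
proof safe
  fix V d
  assume V: "(V, d) \<in> atlas M"
  have o: "open (d ` (V \<inter> W))"
    using chart_image_open_Int V assms(2) by blast
  have "smooth_on (d ` (V \<inter> W)) (\<lambda>x. (\<phi> \<circ> inv_into U c) ((c \<circ> inv_into V d) x))"
  proof (rule smooth_on_compose[OF o chart_image_open[OF assms(1-3)] _ _ assms(4)])
    show "(c \<circ> inv_into V d) ` d ` (V \<inter> W) \<subseteq> c ` W"
      using V by auto
    show "smooth_on (d ` (V \<inter> W)) (c \<circ> inv_into V d)"
      by (rule smooth_on_subset[OF transition_smooth[OF V assms(1)]]) (use assms(3) in auto)
  qed
  moreover have "(\<phi> \<circ> inv_into U c) ((c \<circ> inv_into V d) x) = (\<phi> \<circ> inv_into V d) x"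
    if "x \<in> d ` (V \<inter> W)" for x
    using that V assms(1,3) by auto
  ultimately show "smooth_on (d ` (V \<inter> W)) (\<phi> \<circ> inv_into V d)"
    using smooth_on_cong[OF o, of "\<lambda>x. (\<phi> \<circ> inv_into U c) ((c \<circ> inv_into V d) x)" "\<phi> \<circ> inv_into V d"]
    by blast
qed

lemma smooth_nearI: "openin (mtop M) W \<Longrightarrow> p \<in> W \<Longrightarrow> smooth_fun M W \<phi> \<Longrightarrow> smooth_near M p \<phi>"
  unfolding smooth_near_def by blast

lemma smooth_near_transfer:
  assumes "smooth_near M p \<phi>" "openin (mtop M) W" "p \<in> W" "\<And>q. q \<in> W \<Longrightarrow> \<phi> q = \<psi> q"
  shows "smooth_near M p \<psi>"
proof -
  from assms(1) obtain V where V: "openin (mtop M) V" "p \<in> V" "smooth_fun M V \<phi>"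
    by (auto simp: smooth_near_def)
  have o: "openin (mtop M) (V \<inter> W)"
    by (rule openin_Int[OF V(1) assms(2)])
  have "smooth_fun M (V \<inter> W) \<phi>"
    by (rule smooth_fun_subset[OF V(3)]) simp
  moreover have "smooth_fun M (V \<inter> W) \<phi> \<longleftrightarrow> smooth_fun M (V \<inter> W) \<psi>"
    by (rule smooth_fun_cong[OF o]) (simp add: assms(4))
  ultimately have "smooth_fun M (V \<inter> W) \<psi>"
    by simp
  moreover have "p \<in> V \<inter> W"
    using V(2) assms(3) by simp
  ultimately show ?thesis
    using o by (intro smooth_nearI)
qed

lemma smooth_near_cong:
  assumes "openin (mtop M) W" "p \<in> W" "\<And>q. q \<in> W \<Longrightarrow> \<phi> q = \<psi> q"
  shows "smooth_near M p \<phi> \<longleftrightarrow> smooth_near M p \<psi>"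
  using smooth_near_transfer[OF _ assms(1,2), of \<phi> \<psi>] smooth_near_transfer[OF _ assms(1,2), of \<psi> \<phi>] assms(3)
  by metis

lemma smooth_near_chart:
  assumes "smooth_near M p \<phi>" "(U, c) \<in> atlas M" "p \<in> U"
  obtains W where "openin (mtop M) W" "p \<in> W" "W \<subseteq> U" "smooth_fun M W \<phi>"
    "smooth_on (c ` W) (\<phi> \<circ> inv_into U c)" "open (c ` W)"
proof -
  obtain V where V: "openin (mtop M) V" "p \<in> V" "smooth_fun M V \<phi>"
    using assms(1) unfolding smooth_near_def by blast
  show ?thesis
  proof (rule that)
    show "openin (mtop M) (U \<inter> V)"
      using V(1) chart_open[OF assms(2)] by blast
    show "smooth_fun M (U \<inter> V) \<phi>"
      using V(3) smooth_fun_subset by blast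
    show "smooth_on (c ` (U \<inter> V)) (\<phi> \<circ> inv_into U c)"
      using V(3) assms(2) unfolding smooth_fun_def by blast
    show "open (c ` (U \<inter> V))"
      using chart_image_open_Int[OF assms(2) V(1)] .
  qed (use V assms in auto)
qed

lemma smooth_near_differentiable:
  assumes "smooth_near M p \<phi>" "(U, c) \<in> atlas M" "p \<in> U"
  shows "(\<phi> \<circ> inv_into U c) differentiable (at (c p))"
  using assms by (elim smooth_near_chart) (auto intro: smooth_on_differentiable)

lemma smooth_near_const: "p \<in> carrier_of M \<Longrightarrow> smooth_near M p (\<lambda>q. a)"
  by (rule smooth_nearI[of "carrier_of M"]) (auto simp: smooth_fun_def comp_def smooth_on_const)

text \<open>Linear coordinates are the test functions that detect nonzero coordinate
  vectors.\<close>

lemma smooth_near_coordinate: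
  assumes "(U, c) \<in> atlas M" "p \<in> U"
  shows "smooth_near M p (\<lambda>q. c q \<bullet> u)"
proof (rule smooth_nearI[OF chart_open[OF assms(1)] assms(2)])
  have o: "open (c ` U)"
    using assms(1) chart_image_open chart_open by blast
  have "smooth_on (c ` U) (\<lambda>x. x \<bullet> u)"
    by (rule smooth_on_linear[OF bounded_linear_inner_left o smooth_on_ident[OF o]])
  then have "smooth_on (c ` U) ((\<lambda>q. c q \<bullet> u) \<circ> inv_into U c)"
    using smooth_on_cong[OF o, of "\<lambda>x. x \<bullet> u" "(\<lambda>q. c q \<bullet> u) \<circ> inv_into U c"]
    by (auto simp: f_inv_into_f)
  then show "smooth_fun M U (\<lambda>q. c q \<bullet> u)"
    using smooth_fun_chartI[OF assms(1) chart_open[OF assms(1)]] by blast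
qed

text \<open>Evaluation rule: \<open>F\<close> is an explicit coordinate expression near
  \<open>p\<close>, so \<open>inv_into\<close> disappears. Smoothness is a premise because
  \<open>coord_vec\<close> falls back to 0 without it.\<close>

lemma coord_vec_eqI:
  assumes "(U, c) \<in> atlas M" "p \<in> U" "smooth_near M p \<phi>"
    and "openin (mtop M) W" "p \<in> W" "W \<subseteq> U" "\<And>q. q \<in> W \<Longrightarrow> \<phi> q = F (c q)"
    and "(F has_derivative D) (at (c p))"
  shows "coord_vec M U c p u \<phi> = D u"
proof -
  have "((\<phi> \<circ> inv_into U c) has_derivative D) (at (c p))"
    by (rule has_derivative_transform_within_open[OF assms(8) chart_image_open[OF assms(1,4,6)]])
      (use assms(1,5-7) in auto)
  then show ?thesis
    using assms(3) frechet_derivative_at by (fastforce simp: coord_vec_def)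
qed

lemma coord_vec_cong:
  assumes "(U, c) \<in> atlas M" "p \<in> U" "openin (mtop M) W" "p \<in> W" "\<And>q. q \<in> W \<Longrightarrow> \<phi> q = \<psi> q"
  shows "coord_vec M U c p u \<phi> = coord_vec M U c p u \<psi>"
proof -
  have n: "smooth_near M p \<phi> \<longleftrightarrow> smooth_near M p \<psi>"
    by (rule smooth_near_cong[OF assms(3,4)]) (rule assms(5))
  show ?thesis
  proof (cases "smooth_near M p \<phi>")
    case True
    then have s: "smooth_near M p \<psi>"
      using n by simp
    have "coord_vec M U c p u \<phi> = frechet_derivative (\<psi> \<circ> inv_into U c) (at (c p)) u"
    proof (rule coord_vec_eqI[OF assms(1,2) True])
      show "openin (mtop M) (U \<inter> W)"
        using assms(1,3) chart_open by blast
      show "(\<psi> \<circ> inv_into U c has_derivative frechet_derivative (\<psi> \<circ> inv_into U c) (at (c p))) (at (c p))"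
        using smooth_near_differentiable[OF s assms(1,2)] frechet_derivative_works by blast
    qed (use assms in auto)
    with s show ?thesis
      by (simp add: coord_vec_def)
  next
    case False
    then show ?thesis
      using n by (simp add: coord_vec_def)
  qed
qed

lemma coord_vec_const:
  assumes "(U, c) \<in> atlas M" "p \<in> U" "openin (mtop M) W" "p \<in> W" "\<And>q. q \<in> W \<Longrightarrow> \<phi> q = a"
  shows "coord_vec M U c p u \<phi> = 0"
  using coord_vec_cong[OF assms(1-4), of \<phi> "\<lambda>q. a" u] assms(5) by (simp add: coord_vec_def comp_def)

lemma coord_vec_add_scale:
  assumes "(U, c) \<in> atlas M" "p \<in> U"
  shows "coord_vec M U c p (a *\<^sub>R u + b *\<^sub>R v) =
    vadd (vscale a (coord_vec M U c p u)) (vscale b (coord_vec M U c p v))"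
proof
  fix \<phi>
  show "coord_vec M U c p (a *\<^sub>R u + b *\<^sub>R v) \<phi> =
    vadd (vscale a (coord_vec M U c p u)) (vscale b (coord_vec M U c p v)) \<phi>"
  proof (cases "smooth_near M p \<phi>")
    case True
    then have "linear (frechet_derivative (\<phi> \<circ> inv_into U c) (at (c p)))"
      using assms smooth_near_differentiable linear_frechet_derivative by blast
    then show ?thesis
      using True by (simp add: coord_vec_def vadd_def vscale_def linear_add linear_scale)
  qed (simp add: coord_vec_def vadd_def vscale_def)
qed

lemma coord_vec_zero:
  assumes "(U, c) \<in> atlas M" "p \<in> U"
  shows "coord_vec M U c p 0 = vzero"
  using coord_vec_add_scale[OF assms, of 0 0 0 0] by (simp add: vadd_def vscale_def vzero_def)

lemma coord_vec_nonzero: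
  assumes "(U, c) \<in> atlas M" "p \<in> U" "u \<noteq> 0"
  shows "coord_vec M U c p u \<noteq> vzero"
proof -
  have "coord_vec M U c p u (\<lambda>q. c q \<bullet> u) = u \<bullet> u"
    by (rule coord_vec_eqI[OF assms(1,2) smooth_near_coordinate[OF assms(1,2)]
          chart_open[OF assms(1)] assms(2) order_refl,
          where F = "\<lambda>x. x \<bullet> u" and D = "\<lambda>x. x \<bullet> u"])
      (auto intro!: derivative_eq_intros)
  then show ?thesis
    using assms(3) by (metis vzero_def inner_eq_zero_iff)
qed

text \<open>Chain rule for the transition map. As \<open>tangent_space\<close> collects the vectors
  of all charts, this is what lets a single chart exhaust it.\<close>

lemma coord_vec_change_chart:
  assumes "(U, c) \<in> atlas M" "p \<in> U" "(V, d) \<in> atlas M" "p \<in> V"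
  shows "coord_vec M V d p u = coord_vec M U c p (frechet_derivative (c \<circ> inv_into V d) (at (d p)) u)"
proof
  fix \<phi>
  show "coord_vec M V d p u \<phi> = coord_vec M U c p (frechet_derivative (c \<circ> inv_into V d) (at (d p)) u) \<phi>"
  proof (cases "smooth_near M p \<phi>")
    case True
    let ?T = "c \<circ> inv_into V d"
    have t: "(?T has_derivative frechet_derivative ?T (at (d p))) (at (d p))"
      using transition_smooth[OF assms(3,1)] smooth_on_differentiable assms(2,4) frechet_derivative_works
      by blast
    have s: "((\<phi> \<circ> inv_into U c) has_derivative frechet_derivative (\<phi> \<circ> inv_into U c) (at (c p)))
        (at (?T (d p)))"
      using smooth_near_differentiable[OF True assms(1,2)] frechet_derivative_works assms by auto
    have "coord_vec M V d p u \<phi> =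
        frechet_derivative (\<phi> \<circ> inv_into U c) (at (c p)) (frechet_derivative ?T (at (d p)) u)"
      by (rule coord_vec_eqI[OF assms(3,4) True _ _ _ _ has_derivative_compose[OF t s],
            where W = "U \<inter> V"]) (use assms chart_open in auto)
    then show ?thesis
      using True by (simp add: coord_vec_def)
  qed (simp add: coord_vec_def)
qed

lemma tangent_space_chart:
  assumes "(U, c) \<in> atlas M" "p \<in> U"
  shows "tangent_space M p = range (coord_vec M U c p)"
proof
  show "tangent_space M p \<subseteq> range (coord_vec M U c p)"
    using coord_vec_change_chart[OF assms] by (auto simp: tangent_space_def)
  show "range (coord_vec M U c p) \<subseteq> tangent_space M p"
    using assms by (auto simp: tangent_space_def)
qed

lemma coord_vec_tangent:
  "(U, c) \<in> atlas M \<Longrightarrow> p \<in> U \<Longrightarrow> coord_vec M U c p u \<in> tangent_space M p"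
  by (auto simp: tangent_space_def)

lemma coord_field_chart:
  assumes "(U, c) \<in> atlas M" "openin (mtop M) W" "W \<subseteq> U" "smooth_fun M W \<phi>" "q \<in> W"
  shows "coord_vec M U c q u \<phi> = frechet_derivative (\<phi> \<circ> inv_into U c) (at (c q)) u"
  using smooth_nearI[OF assms(2,5,4)] by (simp add: coord_vec_def)

lemma coord_field_smooth:
  assumes "(U, c) \<in> atlas M" "openin (mtop M) W" "W \<subseteq> U" "smooth_fun M W \<phi>"
  shows "smooth_fun M W (\<lambda>q. coord_vec M U c q u \<phi>)"
proof (rule smooth_fun_chartI[OF assms(1-3)])
  have "smooth_on (c ` W) (\<phi> \<circ> inv_into U c)"
    using assms(1,3,4) unfolding smooth_fun_def by (metis (no_types, lifting) case_prodD inf.absorb2)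
  then have "smooth_on (c ` W) (\<lambda>x. frechet_derivative (\<phi> \<circ> inv_into U c) (at x) u)"
    by (rule smooth_on_derivative)
  moreover have "frechet_derivative (\<phi> \<circ> inv_into U c) (at x) u =
      ((\<lambda>q. coord_vec M U c q u \<phi>) \<circ> inv_into U c) x" if "x \<in> c ` W" for x
    using that coord_field_chart[OF assms] assms(1,3) by (auto simp: subsetD)
  ultimately show "smooth_on (c ` W) ((\<lambda>q. coord_vec M U c q u \<phi>) \<circ> inv_into U c)"
    using smooth_on_cong[OF chart_image_open[OF assms(1-3)],
        of "\<lambda>x. frechet_derivative (\<phi> \<circ> inv_into U c) (at x) u"
          "(\<lambda>q. coord_vec M U c q u \<phi>) \<circ> inv_into U c"]
    by blast
qed

lemma vector_field_coord:
  assumes "(U, c) \<in> atlas M"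
  shows "vector_field M U (\<lambda>q. coord_vec M U c q u)"
  using assms coord_field_smooth coord_vec_tangent by (auto simp: vector_field_def)

text \<open>In the chart, both sides are mixed second derivatives of the coordinate expression of
  \<open>\<phi>\<close>.\<close>

lemma coord_field_commute:
  assumes "(U, c) \<in> atlas M" "p \<in> U" "smooth_near M p \<phi>"
  shows "coord_vec M U c p u (\<lambda>q. coord_vec M U c q v \<phi>) =
    coord_vec M U c p v (\<lambda>q. coord_vec M U c q u \<phi>)"
proof -
  obtain W where W: "openin (mtop M) W" "p \<in> W" "W \<subseteq> U" "smooth_fun M W \<phi>"
    "smooth_on (c ` W) (\<phi> \<circ> inv_into U c)" "open (c ` W)"
    using smooth_near_chart[OF assms(3,1,2)] by blast
  let ?F = "\<phi> \<circ> inv_into U c"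
  have "coord_vec M U c p u (\<lambda>q. coord_vec M U c q v \<phi>) =
      frechet_derivative (\<lambda>x. frechet_derivative ?F (at x) v) (at (c p)) u" for u v
  proof (rule coord_vec_eqI[OF assms(1,2) _ W(1-3)])
    show "smooth_near M p (\<lambda>q. coord_vec M U c q v \<phi>)"
      by (rule smooth_nearI[OF W(1,2) coord_field_smooth[OF assms(1) W(1,3,4)]])
    show "coord_vec M U c q v \<phi> = frechet_derivative ?F (at (c q)) v" if "q \<in> W" for q
      using coord_field_chart[OF assms(1) W(1,3,4) that] .
    show "((\<lambda>x. frechet_derivative ?F (at x) v) has_derivative
        frechet_derivative (\<lambda>x. frechet_derivative ?F (at x) v) (at (c p))) (at (c p))"
      using smooth_on_differentiable[OF smooth_on_derivative[OF W(5)]] W(2) frechet_derivative_works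
      by blast
  qed
  then show ?thesis
    using second_derivative_symmetric[OF W(6,5)] W(2) by simp
qed

text \<open>The advantage of coordinate fields: the bracket drops out of both the torsion identity
  and the curvature.\<close>

lemma lie_bracket_coord:
  assumes "(U, c) \<in> atlas M" "p \<in> U"
  shows "lie_bracket M (\<lambda>q. coord_vec M U c q u) (\<lambda>q. coord_vec M U c q v) p = vzero"
  using coord_field_commute[OF assms] by (auto simp: lie_bracket_def vzero_def)

end

section \<open>The product manifold\<close>

definition product_chart :: "('m \<Rightarrow> 'e) \<Rightarrow> real \<times> 'm \<Rightarrow> real \<times> 'e" where
  "product_chart c = (\<lambda>(t, p). (t, c p))"

lemma product_chart_apply [simp]: "product_chart c (t, p) = (t, c p)"
  by (simp add: product_chart_def)

lemma atlas_product: "atlas (product_manifold I M) = {(I \<times> U, product_chart c) | U c. (U, c) \<in> atlas M}"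
  by (simp add: product_manifold_def product_chart_def)

lemma mtop_product: "mtop (product_manifold I M) = prod_topology (top_of_set I) (mtop M)"
  by (simp add: product_manifold_def)

lemma carrier_product: "carrier_of (product_manifold I M) = I \<times> carrier_of M"
  by (simp add: mtop_product)

lemma product_chart_inv:
  "inj_on c U \<Longrightarrow> t \<in> I \<Longrightarrow> x \<in> c ` U \<Longrightarrow>
    inv_into (I \<times> U) (product_chart c) (t, x) = (t, inv_into U c x)"
  by (rule inv_into_f_eq) (auto simp: inj_on_def f_inv_into_f inv_into_into)

locale product_atlas = smooth_atlas M
  for M :: "('m, 'e::euclidean_space) manifold" +
  fixes I :: "real set"
  assumes open_I: "open I"
begin

abbreviation "P \<equiv> product_manifold I M"

lemma product_chart_in_atlas: "(U, c) \<in> atlas M \<Longrightarrow> (I \<times> U, product_chart c) \<in> atlas P"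
  by (auto simp: atlas_product)

lemma openin_product_Times: "openin (mtop M) W \<Longrightarrow> openin (mtop P) (I \<times> W)"
  by (simp add: mtop_product openin_prod_Times_iff)

text \<open>An open set is a union of boxes, and a product chart maps boxes to boxes. Openness of
  \<open>I\<close> turns relatively open sets of times into open ones.\<close>

lemma product_chart_image_open:
  assumes "(U, c) \<in> atlas M" "openin (mtop P) W" "W \<subseteq> I \<times> U"
  shows "open (product_chart c ` W)"
proof (subst open_subopen, rule ballI)
  fix y
  assume "y \<in> product_chart c ` W"
  then obtain t p where tp: "(t, p) \<in> W" and y: "y = product_chart c (t, p)"
    by auto
  have "\<forall>x y. (x, y) \<in> W \<longrightarrow> (\<exists>A B. openin (top_of_set I) A \<and> openin (mtop M) B \<and> x \<in> A \<and> y \<in> B \<and> A \<times> B \<subseteq> W)"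
    using assms(2) by (simp only: mtop_product openin_prod_topology_alt)
  with tp obtain A B where AB: "openin (top_of_set I) A" "openin (mtop M) B" "t \<in> A" "p \<in> B" "A \<times> B \<subseteq> W"
    by metis
  have "open A"
    using openin_open_trans[OF AB(1) open_I] .
  moreover have "B \<subseteq> U"
    using AB(3,5) assms(3) by auto
  then have "open (c ` B)"
    by (rule chart_image_open[OF assms(1) AB(2)])
  ultimately have "open (A \<times> c ` B)"
    by (rule open_Times)
  moreover have "A \<times> c ` B \<subseteq> product_chart c ` W"
    using AB(5) by (force simp: product_chart_def)
  moreover have "y \<in> A \<times> c ` B"
    using AB(3,4) by (simp add: y)
  ultimately show "\<exists>T. open T \<and> y \<in> T \<and> T \<subseteq> product_chart c ` W"
    by metis
qed

text \<open>A transition map of the product is the identity in time paired with a transition map of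
  \<open>M\<close>. All results on charts now hold for the product too, under the prefix
  \<open>product\<close>.\<close>

sublocale product: smooth_atlas P
proof
  fix W k
  assume "(W, k) \<in> atlas P"
  then obtain U c where U: "(U, c) \<in> atlas M" and W: "W = I \<times> U" and k: "k = product_chart c"
    by (auto simp: atlas_product)
  show "openin (mtop P) W"
    unfolding W by (rule openin_product_Times[OF chart_open[OF U]])
  show "inj_on k W"
    using chart_inj[OF U] by (auto simp: W k inj_on_def)
  show "open (k ` Q)" if "openin (mtop P) Q" "Q \<subseteq> W" for Q
    using product_chart_image_open U that by (simp add: W k)
  show "smooth_on (k ` (W \<inter> X)) (l \<circ> inv_into W k)" if Xl: "(X, l) \<in> atlas P" for X l
  proof -
    obtain V d where V: "(V, d) \<in> atlas M" and X: "X = I \<times> V" and l: "l = product_chart d"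
      using Xl by (auto simp: atlas_product)
    have o: "open (c ` (U \<inter> V))"
      by (rule chart_image_open_Int[OF U chart_open[OF V]])
    have i: "k ` (W \<inter> X) = I \<times> c ` (U \<inter> V)"
      by (auto simp: W X k product_chart_def image_iff)
    have o': "open (I \<times> c ` (U \<inter> V))"
      by (rule open_Times[OF open_I o])
    have "smooth_on (I \<times> c ` (U \<inter> V)) (\<lambda>x. (fst x, (d \<circ> inv_into U c) (snd x)))"
      by (rule smooth_on_Pair[OF o' smooth_on_linear[OF bounded_linear_fst o' smooth_on_ident[OF o']]
            smooth_on_compose[OF o' o _ smooth_on_linear[OF bounded_linear_snd o' smooth_on_ident[OF o']]
              transition_smooth[OF U V]]]) auto
    moreover have "(fst x, (d \<circ> inv_into U c) (snd x)) = (l \<circ> inv_into W k) x"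
      if "x \<in> I \<times> c ` (U \<inter> V)" for x
      using that product_chart_inv[OF chart_inj[OF U]] by (auto simp: W k l)
    ultimately show ?thesis
      unfolding i
      using smooth_on_cong[OF o', of "\<lambda>x. (fst x, (d \<circ> inv_into U c) (snd x))" "l \<circ> inv_into W k"]
      by blast
  qed
next
  fix q
  assume "q \<in> carrier_of P"
  then show "\<exists>W k. (W, k) \<in> atlas P \<and> q \<in> W"
    using chart_exists[of "snd q"] product_chart_in_atlas by (auto simp: carrier_product) blast
qed

text \<open>Separated functions cover all that gets differentiated explicitly: \<open>fst\<close>,
  pullbacks along \<open>snd\<close>, and metric components, which are a function of time times a
  component of \<open>g\<close>.\<close>

lemma smooth_near_product:
  assumes "smooth_on I r" "smooth_near M p \<phi>" "t \<in> I"
  shows "smooth_near P (t, p) (\<lambda>q. r (fst q) * \<phi> (snd q))"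
proof -
  have "p \<in> carrier_of M"
    using assms(2) openin_subset unfolding smooth_near_def by blast
  then obtain U c where U: "(U, c) \<in> atlas M" "p \<in> U"
    using chart_exists by blast
  obtain W where W: "openin (mtop M) W" "p \<in> W" "W \<subseteq> U" "smooth_fun M W \<phi>"
    "smooth_on (c ` W) (\<phi> \<circ> inv_into U c)" "open (c ` W)"
    using smooth_near_chart[OF assms(2) U] by blast
  have o: "open (I \<times> c ` W)"
    by (rule open_Times[OF open_I W(6)])
  have i: "product_chart c ` (I \<times> W) = I \<times> c ` W"
    by (auto simp: product_chart_def image_iff)
  have "smooth_on (I \<times> c ` W) (\<lambda>x. r (fst x) * (\<phi> \<circ> inv_into U c) (snd x))"
    by (rule smooth_on_mult[OF o
          smooth_on_compose[OF o open_I _ smooth_on_linear[OF bounded_linear_fst o smooth_on_ident[OF o]] assms(1)]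
          smooth_on_compose[OF o W(6) _ smooth_on_linear[OF bounded_linear_snd o smooth_on_ident[OF o]] W(5)]])
      auto
  moreover have "r (fst x) * (\<phi> \<circ> inv_into U c) (snd x) =
      ((\<lambda>q. r (fst q) * \<phi> (snd q)) \<circ> inv_into (I \<times> U) (product_chart c)) x" if "x \<in> I \<times> c ` W" for x
    using that product_chart_inv[OF chart_inj[OF U(1)]] W(3) by auto
  ultimately have "smooth_on (I \<times> c ` W)
      ((\<lambda>q. r (fst q) * \<phi> (snd q)) \<circ> inv_into (I \<times> U) (product_chart c))"
    using smooth_on_cong[OF o, of "\<lambda>x. r (fst x) * (\<phi> \<circ> inv_into U c) (snd x)"
        "(\<lambda>q. r (fst q) * \<phi> (snd q)) \<circ> inv_into (I \<times> U) (product_chart c)"]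
    by blast
  then have "smooth_fun P (I \<times> W) (\<lambda>q. r (fst q) * \<phi> (snd q))"
    using product.smooth_fun_chartI[OF product_chart_in_atlas[OF U(1)] openin_product_Times[OF W(1)]]
      W(3) i by auto
  then show ?thesis
    using product.smooth_nearI[OF openin_product_Times[OF W(1)]] W(2) assms(3) by blast
qed

abbreviation pvec :: "'m set \<Rightarrow> ('m \<Rightarrow> 'e) \<Rightarrow> real \<times> 'm \<Rightarrow> real \<times> 'e \<Rightarrow> (real \<times> 'm) tvec" where
  "pvec U c \<equiv> coord_vec P (I \<times> U) (product_chart c)"

lemma pvec_product:
  assumes "(U, c) \<in> atlas M" "p \<in> U" "t \<in> I" "smooth_on I r" "(r has_field_derivative r') (at t)"
    "smooth_near M p \<phi>"
  shows "pvec U c (t, p) (s, u) (\<lambda>q. r (fst q) * \<phi> (snd q)) =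
    s * r' * \<phi> p + r t * coord_vec M U c p u \<phi>"
proof -
  let ?\<phi> = "\<phi> \<circ> inv_into U c"
  let ?d = "frechet_derivative ?\<phi> (at (c p))"
  have d\<phi>: "(?\<phi> has_derivative ?d) (at (c p))"
    using smooth_near_differentiable[OF assms(6,1,2)] frechet_derivative_works by blast
  have 1: "((\<lambda>x. r (fst x)) has_derivative (\<lambda>w. fst w * r')) (at (t, c p))"
    using has_derivative_compose[OF has_derivative_fst[OF has_derivative_ident], of r "(*) r'" "(t, c p)" UNIV]
      assms(5) by (simp add: has_field_derivative_def mult.commute)
  have 2: "((\<lambda>x. ?\<phi> (snd x)) has_derivative (\<lambda>w. ?d (snd w))) (at (t, c p))"
    using has_derivative_compose[OF has_derivative_snd[OF has_derivative_ident], of ?\<phi> ?d "(t, c p)" UNIV]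
      d\<phi> by simp
  have "((\<lambda>x. r (fst x) * ?\<phi> (snd x)) has_derivative
      (\<lambda>w. r t * ?d (snd w) + fst w * r' * \<phi> p)) (at (t, c p))"
    using has_derivative_mult[OF 1 2] assms(1,2) by simp
  then have d: "((\<lambda>x. r (fst x) * ?\<phi> (snd x)) has_derivative
      (\<lambda>w. r t * ?d (snd w) + fst w * r' * \<phi> p)) (at (product_chart c (t, p)))"
    by (simp only: product_chart_apply)
  have "(t, p) \<in> I \<times> U"
    using assms by simp
  then have "pvec U c (t, p) (s, u) (\<lambda>q. r (fst q) * \<phi> (snd q)) =
      r t * ?d (snd (s, u)) + fst (s, u) * r' * \<phi> p"
    by (rule product.coord_vec_eqI[OF product_chart_in_atlas[OF assms(1)] _
          smooth_near_product[OF assms(4,6,3)] openin_product_Times[OF chart_open[OF assms(1)]]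
          _ order_refl _ d])
      (use assms(1-3) in \<open>auto simp: product_chart_def\<close>)
  then show ?thesis
    using assms(6) by (simp add: coord_vec_def)
qed

lemma pvec_fst:
  assumes "(U, c) \<in> atlas M" "p \<in> U" "t \<in> I"
  shows "pvec U c (t, p) (s, u) fst = s"
proof -
  have p: "p \<in> carrier_of M"
    using assms chart_open openin_subset by blast
  \<comment> \<open>The time coordinate as a separated function, with the identity in time and the
    constant 1 on \<open>M\<close>.\<close>
  have "pvec U c (t, p) (s, u) (\<lambda>q. fst q * (\<lambda>_. 1) (snd q)) = s"
    by (subst pvec_product[OF assms smooth_on_ident[OF open_I] DERIV_ident smooth_near_const[OF p]])
      (simp add: coord_vec_const[OF assms(1,2) chart_open[OF assms(1)] assms(2)])
  then show ?thesis
    by simp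
qed

lemma push_forward_pvec:
  assumes "(U, c) \<in> atlas M" "p \<in> U" "t \<in> I"
  shows "push_forward M p snd (pvec U c (t, p) (s, u)) = coord_vec M U c p u"
proof
  fix \<phi>
  show "push_forward M p snd (pvec U c (t, p) (s, u)) \<phi> = coord_vec M U c p u \<phi>"
  proof (cases "smooth_near M p \<phi>")
    case True
    have "pvec U c (t, p) (s, u) (\<lambda>q. 1 * \<phi> (snd q)) = coord_vec M U c p u \<phi>"
      by (subst pvec_product[OF assms smooth_on_const DERIV_const True]) simp
    then show ?thesis
      using True by (simp add: push_forward_def comp_def)
  qed (simp add: push_forward_def coord_vec_def)
qed

lemma tangent_product_cases:
  assumes "(U, c) \<in> atlas M" "p \<in> U" "t \<in> I" "v \<in> tangent_space P (t, p)"
  obtains s u where "v = pvec U c (t, p) (s, u)"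
proof -
  have "v \<in> range (pvec U c (t, p))"
    using assms product.tangent_space_chart[OF product_chart_in_atlas[OF assms(1)], of "(t, p)"] by simp
  then show ?thesis
    using that by (metis rangeE surj_pair)
qed

lemma grw_metric_pvec:
  assumes "(U, c) \<in> atlas M" "p \<in> U" "t \<in> I"
  shows "grw_metric M f g (t, p) (pvec U c (t, p) (s, u)) (pvec U c (t, p) (s', u')) =
    - (s * s') + (f t)\<^sup>2 * g p (coord_vec M U c p u) (coord_vec M U c p u')"
  by (simp add: grw_metric_def pvec_fst[OF assms] push_forward_pvec[OF assms])

end

section \<open>The curvature in planes that contain the time direction\<close>

context smooth_atlas
begin

section \<open>Pointwise facts on vector fields, connections and metrics\<close>

lemma vector_field_tangent: "vector_field M W X \<Longrightarrow> p \<in> W \<Longrightarrow> X p \<in> tangent_space M p"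
  by (simp add: vector_field_def)

lemma vzero_tangent: "p \<in> carrier_of M \<Longrightarrow> vzero \<in> tangent_space M p"
  using chart_exists coord_vec_tangent coord_vec_zero by metis

lemma smooth_fun_const: "smooth_fun M W (\<lambda>q. a)"
  by (simp add: smooth_fun_def comp_def smooth_on_const)

lemma vector_field_zero:
  assumes "openin (mtop M) W" "\<And>q. q \<in> W \<Longrightarrow> L q = vzero"
  shows "vector_field M W L"
  unfolding vector_field_def
proof (intro conjI ballI allI impI)
  fix p
  assume "p \<in> W"
  then show "L p \<in> tangent_space M p"
    using assms vzero_tangent openin_subset by fastforce
next
  fix V and \<phi> :: "'m \<Rightarrow> real"
  assume V: "openin (mtop M) V \<and> V \<subseteq> W \<and> smooth_fun M V \<phi>"
  have "L q \<phi> = 0" if "q \<in> V" for q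
    using V that assms(2)[of q] by (auto simp: vzero_def)
  then show "smooth_fun M V (\<lambda>p. L p \<phi>)"
    using smooth_fun_cong[of V "\<lambda>p. L p \<phi>" "\<lambda>_. 0"] V smooth_fun_const by simp
qed

text \<open>The factor that is \<open>0\<close> on \<open>W\<close> and \<open>1\<close> outside is smooth on \<open>W\<close> and leaves \<open>L\<close> unchanged, also
  outside \<open>W\<close>, where \<open>L\<close> is arbitrary.\<close>

lemma connection_zero:
  assumes "connection M D" "openin (mtop M) W" "\<And>q. q \<in> W \<Longrightarrow> L q = vzero" "vector_field M W Y" "p \<in> W"
  shows "D L Y p = vzero"
proof -
  define a where "a q = (if q \<in> W then 0 else 1 :: real)" for q
  have a: "smooth_fun M W a"
    using smooth_fun_cong[OF assms(2), of a "\<lambda>_. 0"] smooth_fun_const by (simp add: a_def)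
  have L: "(\<lambda>q. vadd (vscale (a q) (L q)) (vscale 0 (L q))) = L"
    using assms(3) by (auto simp: a_def vadd_def vscale_def vzero_def fun_eq_iff)
  have Lf: "vector_field M W L"
    by (rule vector_field_zero[OF assms(2)]) (rule assms(3))
  have "\<forall>X X' Y a b. vector_field M W X \<and> vector_field M W X' \<and> vector_field M W Y \<and>
      smooth_fun M W a \<and> smooth_fun M W b \<longrightarrow>
      (\<forall>p\<in>W. D (\<lambda>q. vadd (vscale (a q) (X q)) (vscale (b q) (X' q))) Y p =
         vadd (vscale (a p) (D X Y p)) (vscale (b p) (D X' Y p)))"
    using assms(1,2) unfolding connection_def by simp
  from this[rule_format, of L L Y a "\<lambda>_. 0" p]
  have "D (\<lambda>q. vadd (vscale (a q) (L q)) (vscale 0 (L q))) Y p =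
      vadd (vscale (a p) (D L Y p)) (vscale 0 (D L Y p))"
    using Lf assms(4,5) a smooth_fun_const by blast
  then show ?thesis
    unfolding L using assms(5) by (simp add: a_def vadd_def vscale_def vzero_def)
qed

lemma
  assumes "pseudo_riemannian_metric M g" "p \<in> carrier_of M"
    and "u \<in> tangent_space M p" "v \<in> tangent_space M p"
  shows metric_sym: "g p u v = g p v u"
    and metric_linear: "w \<in> tangent_space M p \<Longrightarrow>
      g p (vadd (vscale a u) (vscale b v)) w = a * g p u w + b * g p v w"
proof -
  have "g p u v = g p v u \<and> (\<forall>w\<in>tangent_space M p. \<forall>a b.
      g p (vadd (vscale a u) (vscale b v)) w = a * g p u w + b * g p v w)"
    using assms(1)[unfolded pseudo_riemannian_metric_def, THEN conjunct1, THEN bspec, OF assms(2),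
        THEN bspec, OF assms(3), THEN bspec, OF assms(4)] .
  then show "g p u v = g p v u"
    "w \<in> tangent_space M p \<Longrightarrow>
      g p (vadd (vscale a u) (vscale b v)) w = a * g p u w + b * g p v w"
    by simp_all
qed

text \<open>Nondegeneracy of \<open>g\<close> applied to one nonzero vector, which exists because a
  Euclidean space has a nonempty basis. The component found here is what \<open>k\<close> is finally
  cancelled against.\<close>

lemma metric_coord_nonzero:
  assumes "pseudo_riemannian_metric M g" "(U, c) \<in> atlas M" "p \<in> U"
  shows "\<exists>u v. g p (coord_vec M U c p u) (coord_vec M U c p v) \<noteq> 0"
proof -
  have p: "p \<in> carrier_of M"
    using assms(2,3) chart_open openin_subset by blast
  obtain u :: 'e where "u \<noteq> 0"
    using nonempty_Basis nonzero_Basis by blast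
  then have "coord_vec M U c p u \<noteq> vzero"
    using coord_vec_nonzero[OF assms(2,3)] by blast
  moreover have "\<forall>u\<in>tangent_space M p. (\<forall>v\<in>tangent_space M p. g p u v = 0) \<longrightarrow> u = vzero"
    by (rule assms(1)[unfolded pseudo_riemannian_metric_def, THEN conjunct2, THEN conjunct1, THEN bspec, OF p])
  ultimately show ?thesis
    using coord_vec_tangent[OF assms(2,3)] tangent_space_chart[OF assms(2,3)] by (metis rangeE)
qed

lemma smooth_fun_metric_coord:
  assumes "pseudo_riemannian_metric M g" "(U, c) \<in> atlas M"
  shows "smooth_fun M U (\<lambda>p. g p (coord_vec M U c p u) (coord_vec M U c p v))"
proof -
  have "\<forall>W X Y. openin (mtop M) W \<and> vector_field M W X \<and> vector_field M W Y \<longrightarrow>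
        smooth_fun M W (\<lambda>p. g p (X p) (Y p))"
    by (rule assms(1)[unfolded pseudo_riemannian_metric_def, THEN conjunct2, THEN conjunct2, THEN conjunct2])
  then show ?thesis
    using vector_field_coord[OF assms(2)] chart_open[OF assms(2)] by simp
qed

end

text \<open>The setting over one chart of \<open>M\<close>: on \<open>I \<times> U\<close> the time
  direction and the directions of \<open>M\<close> are given by coordinate fields. \<open>D\<close>
  is any Levi-Civita connection of the warped metric.\<close>

locale grw_chart = product_atlas M I
  for M :: "('m, 'e::euclidean_space) manifold" and I :: "real set" +
  fixes g :: "'m \<Rightarrow> 'm tvec \<Rightarrow> 'm tvec \<Rightarrow> real"
    and f :: "real \<Rightarrow> real"
    and a b :: real
    and D :: "(real \<times> 'm) vfield \<Rightarrow> (real \<times> 'm) vfield \<Rightarrow> (real \<times> 'm) vfield"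
    and U :: "'m set" and c :: "'m \<Rightarrow> 'e"
  assumes metric: "pseudo_riemannian_metric M g"
    and f_pos: "t \<in> I \<Longrightarrow> f t > 0"
    and f_affine: "t \<in> I \<Longrightarrow> f t = a * t + b"
    and levi: "levi_civita P (grw_metric M f g) D"
    and chart: "(U, c) \<in> atlas M"
begin

definition B where "B = grw_metric M f g"

text \<open>One family indexed by constant coefficients contains \<open>T\<close> and every
  \<open>V u\<close>, and its values at a point are all the tangent vectors there.\<close>

definition E where "E w q = pvec U c q w"

definition h where "h u v p = g p (coord_vec M U c p u) (coord_vec M U c p v)"

abbreviation "T \<equiv> E (1, 0)"
abbreviation "V u \<equiv> E (0, u)"

lemmas chart' = product_chart_in_atlas[OF chart]

lemma open_chart: "openin (mtop P) (I \<times> U)"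
  by (rule openin_product_Times[OF chart_open[OF chart]])

lemma E_field: "vector_field P (I \<times> U) (E w)"
  unfolding E_def by (rule product.vector_field_coord[OF chart'])

lemma E_tangent: "q \<in> I \<times> U \<Longrightarrow> E w q \<in> tangent_space P q"
  by (rule product.vector_field_tangent[OF E_field])

lemma tangent_cases:
  assumes "q \<in> I \<times> U" "v \<in> tangent_space P q"
  obtains s u where "v = E (s, u) q"
  using assms by (cases q) (auto simp: E_def elim: tangent_product_cases[OF chart])

lemma B_E:
  "q \<in> I \<times> U \<Longrightarrow> B q (E (s, u) q) (E (s', u') q) = - (s * s') + (f (fst q))\<^sup>2 * h u u' (snd q)"
  by (cases q) (simp add: B_def E_def h_def grw_metric_pvec[OF chart])

lemma chart_carrier: "p \<in> U \<Longrightarrow> p \<in> carrier_of M"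
  using chart_open[OF chart] openin_subset by blast

lemma h_sym: "p \<in> U \<Longrightarrow> h u v p = h v u p"
  unfolding h_def using metric_sym[OF metric chart_carrier] coord_vec_tangent[OF chart] by simp

lemma h_linear: "p \<in> U \<Longrightarrow> h (r *\<^sub>R u + s *\<^sub>R v) w p = r * h u w p + s * h v w p"
  unfolding h_def using metric_linear[OF metric chart_carrier] coord_vec_tangent[OF chart]
  by (simp add: coord_vec_add_scale[OF chart])

lemma h_zero_right: "p \<in> U \<Longrightarrow> h u 0 p = 0"
  using h_linear[of p 0 0 0 0 u] h_sym[of p u 0] by simp

lemma h_zero_left: "p \<in> U \<Longrightarrow> h 0 u p = 0"
  using h_zero_right[of p u] h_sym[of p 0 u] by simp

text \<open>The algebra of the warped metric is inherited from \<open>g\<close> by writing tangent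
  vectors in components; \<open>B_linear\<close> is obtained in the same way.\<close>

lemma B_sym:
  assumes "q \<in> I \<times> U" "v \<in> tangent_space P q" "w \<in> tangent_space P q"
  shows "B q v w = B q w v"
proof -
  obtain s u where v: "v = E (s, u) q"
    using tangent_cases assms(1,2) by blast
  obtain s' u' where w: "w = E (s', u') q"
    using tangent_cases assms(1,3) by blast
  show ?thesis
    using assms(1) h_sym[of "snd q" u u'] unfolding v w by (auto simp: B_E mult.commute)
qed

lemma E_linear:
  "q \<in> I \<times> U \<Longrightarrow> vadd (vscale r (E v q)) (vscale s (E w q)) = E (r *\<^sub>R v + s *\<^sub>R w) q"
  unfolding E_def by (simp only: product.coord_vec_add_scale[OF chart'])

lemma B_linear:
  assumes "q \<in> I \<times> U" "v \<in> tangent_space P q" "w \<in> tangent_space P q" "z \<in> tangent_space P q"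
  shows "B q (vadd (vscale r v) (vscale s w)) z = r * B q v z + s * B q w z"
proof -
  obtain s1 u1 where v: "v = E (s1, u1) q"
    using tangent_cases assms(1,2) by blast
  obtain s2 u2 where w: "w = E (s2, u2) q"
    using tangent_cases assms(1,3) by blast
  obtain s3 u3 where z: "z = E (s3, u3) q"
    using tangent_cases assms(1,4) by blast
  have "snd q \<in> U"
    using assms(1) by auto
  then show ?thesis
    unfolding v w z using assms(1) by (simp add: E_linear B_E h_linear algebra_simps)
qed

lemma E_const: "q \<in> I \<times> U \<Longrightarrow> (\<And>q. q \<in> I \<times> U \<Longrightarrow> \<phi> q = k) \<Longrightarrow> E w q \<phi> = 0"
  unfolding E_def by (rule product.coord_vec_const[OF chart' _ open_chart])

text \<open>The factor \<open>h u v\<close> is constant in time, so only \<open>r\<close> is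
  differentiated; smoothness of \<open>h u v\<close> still enters, to stay clear of the default
  value 0.\<close>

lemma T_deriv:
  assumes "q \<in> I \<times> U" "\<And>q. q \<in> I \<times> U \<Longrightarrow> \<phi> q = r (fst q) * h u v (snd q)"
    and "smooth_on I r" "(r has_field_derivative r') (at (fst q))"
  shows "T q \<phi> = r' * h u v (snd q)"
proof -
  obtain t p where q: "q = (t, p)" "t \<in> I" "p \<in> U"
    using assms(1) by auto
  have "smooth_near M p (h u v)"
    unfolding h_def
    by (rule smooth_nearI[OF chart_open[OF chart] q(3) smooth_fun_metric_coord[OF metric chart]])
  then have "T q (\<lambda>q. r (fst q) * h u v (snd q)) = 1 * r' * h u v p + r t * coord_vec M U c p 0 (h u v)"
    unfolding q(1) E_def using assms(4) q by (intro pvec_product[OF chart q(3,2) assms(3)]) auto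
  moreover have "T q \<phi> = T q (\<lambda>q. r (fst q) * h u v (snd q))"
    unfolding E_def by (rule product.coord_vec_cong[OF chart' assms(1) open_chart assms(1,2)])
  ultimately show ?thesis
    using coord_vec_zero[OF chart q(3)] by (simp add: q(1) vzero_def)
qed

section \<open>Covariant derivatives of the coordinate fields\<close>

lemma conn: "connection P D"
  using levi unfolding levi_civita_def by blast

lemma D_field:
  "vector_field P (I \<times> U) X \<Longrightarrow> vector_field P (I \<times> U) Y \<Longrightarrow> vector_field P (I \<times> U) (D X Y)"
  using conn[unfolded connection_def, THEN spec, THEN mp, OF open_chart, THEN conjunct1, rule_format] by simp

lemma D_tangent:
  "vector_field P (I \<times> U) X \<Longrightarrow> vector_field P (I \<times> U) Y \<Longrightarrow> q \<in> I \<times> U \<Longrightarrow> D X Y q \<in> tangent_space P q"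
  by (rule product.vector_field_tangent[OF D_field])

lemma lie_bracket_E: "q \<in> I \<times> U \<Longrightarrow> lie_bracket P (E v) (E w) q = vzero"
  unfolding E_def by (rule product.lie_bracket_coord[OF chart'])

lemma D_commute:
  assumes "q \<in> I \<times> U"
  shows "D (E v) (E w) q = D (E w) (E v) q"
proof -
  have "D (E v) (E w) q = vadd (D (E w) (E v) q) (lie_bracket P (E v) (E w) q)"
    by (rule levi[unfolded levi_civita_def, THEN conjunct2, THEN conjunct1, rule_format, of "I \<times> U"])
      (simp_all only: open_chart E_field assms simp_thms)
  also have "lie_bracket P (E v) (E w) q = vzero"
    by (rule lie_bracket_E[OF assms])
  finally show ?thesis
    by (simp add: vadd_def vzero_def)
qed

lemma D_metric:
  assumes "q \<in> I \<times> U" "vector_field P (I \<times> U) X" "vector_field P (I \<times> U) Y" "vector_field P (I \<times> U) Z"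
  shows "X q (\<lambda>q. B q (Y q) (Z q)) = B q (D X Y q) (Z q) + B q (Y q) (D X Z q)"
  using levi[unfolded levi_civita_def, THEN conjunct2, THEN conjunct2, rule_format, of "I \<times> U" X Y Z q]
    open_chart assms by (simp add: B_def)

text \<open>Differentiate the constant \<open>B q (T q) (T q) = - 1\<close>.\<close>

lemma DE_T_T:
  assumes "q \<in> I \<times> U"
  shows "B q (D (E w) T q) (T q) = 0"
proof -
  have "B q (T q) (T q) = - 1" if "q \<in> I \<times> U" for q
    using that h_zero_left by (auto simp: B_E)
  then have "E w q (\<lambda>q. B q (T q) (T q)) = 0"
    by (rule E_const[OF assms])
  then show ?thesis
    using D_metric[OF assms E_field[of w] E_field E_field] B_sym[OF assms]
      D_tangent[OF E_field E_field assms] E_tangent[OF assms] by simp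
qed

text \<open>Differentiate the orthogonality of \<open>T\<close> and \<open>V u\<close>.\<close>

lemma DE_T_V:
  assumes "q \<in> I \<times> U"
  shows "B q (D (E w) T q) (V u q) = - B q (T q) (D (E w) (V u) q)"
proof -
  have "B q (T q) (V u q) = 0" if "q \<in> I \<times> U" for q
    using that h_zero_left by (auto simp: B_E)
  then have "E w q (\<lambda>q. B q (T q) (V u q)) = 0"
    by (rule E_const[OF assms])
  then show ?thesis
    using D_metric[OF assms E_field[of w] E_field E_field] by simp
qed

text \<open>The time lines are geodesics: moving \<open>D T\<close> onto \<open>V u\<close> and
  swapping by vanishing torsion gives \<open>- B (T, D (V u) T)\<close>, which is 0 since
  \<open>T\<close> has constant length.\<close>

lemma DT_T_zero:
  assumes "q \<in> I \<times> U" "v \<in> tangent_space P q"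
  shows "B q (D T T q) v = 0"
proof -
  obtain s u where v: "v = E (s, u) q"
    using tangent_cases assms by blast
  have t: "D T T q \<in> tangent_space P q"
    by (intro D_tangent E_field assms)
  have "B q (D T T q) (V u q) = - B q (T q) (D (V u) T q)"
    using DE_T_V[OF assms(1)] D_commute[OF assms(1)] by simp
  also have "\<dots> = 0"
    using DE_T_T[OF assms(1)] B_sym[OF assms(1) E_tangent D_tangent[OF E_field E_field]] assms(1) by simp
  finally have 0: "B q (V u q) (D T T q) = 0"
    using B_sym[OF assms(1) E_tangent t] assms(1) by simp
  have "v = vadd (vscale s (T q)) (vscale 1 (V u q))"
    unfolding v by (simp add: E_linear[OF assms(1)])
  then have "B q v (D T T q) = s * B q (T q) (D T T q) + 1 * B q (V u q) (D T T q)"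
    using B_linear[OF assms(1) E_tangent E_tangent t] assms(1) by simp
  also have "\<dots> = 0"
    using 0 DE_T_T[OF assms(1)] B_sym[OF assms(1) E_tangent t] assms(1) by simp
  finally show ?thesis
    using B_sym[OF assms(1) t assms(2)] by simp
qed

lemma smooth_affine: "smooth_on I (\<lambda>t. x * t + y)" for x y :: real
  by (intro smooth_on_add[OF open_I] smooth_on_mult[OF open_I] smooth_on_const smooth_on_ident[OF open_I])

text \<open>The left side equals \<open>- B (T, D (V u) (V v))\<close>, hence is symmetric in
  \<open>u\<close> and \<open>v\<close>. So the time derivative of \<open>B (V u, V v)\<close>, that
  is of the square of \<open>f\<close> times \<open>h u v\<close>, is twice the left side.\<close>

lemma DV_T_V:
  assumes "q \<in> I \<times> U"
  shows "B q (D (V u) T q) (V v q) = a * f (fst q) * h u v (snd q)"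
proof -
  have sym: "B q (D (V v) T q) (V u q) = B q (D (V u) T q) (V v q)"
    using DE_T_V[OF assms, of "(0, v)" u] DE_T_V[OF assms, of "(0, u)" v]
      D_commute[OF assms, of "(0, v)" "(0, u)"] by simp
  have "T q (\<lambda>q. B q (V u q) (V v q)) = 2 * a * f (fst q) * h u v (snd q)"
  proof (rule T_deriv[OF assms])
    \<comment> \<open>\<open>f\<close> is known only on \<open>I\<close>; the affine expression has
      a derivative that can be computed directly.\<close>
    show "B q (V u q) (V v q) = ((a * fst q + b) * (a * fst q + b)) * h u v (snd q)" if "q \<in> I \<times> U" for q
      using that f_affine[of "fst q"] by (auto simp: B_E power2_eq_square)
    show "smooth_on I (\<lambda>t. (a * t + b) * (a * t + b))"
      by (intro smooth_on_mult[OF open_I] smooth_affine)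
    show "((\<lambda>t. (a * t + b) * (a * t + b)) has_field_derivative 2 * a * f (fst q)) (at (fst q))"
      using assms f_affine[of "fst q"] by (auto intro!: derivative_eq_intros)
  qed
  also have "T q (\<lambda>q. B q (V u q) (V v q)) = B q (D (V u) T q) (V v q) + B q (D (V v) T q) (V u q)"
    using D_metric[OF assms E_field E_field E_field, of "(1, 0)" "(0, u)" "(0, v)"]
      D_commute[OF assms, of "(1, 0)"] B_sym[OF assms E_tangent D_tangent[OF E_field E_field]] assms
    by simp
  finally show ?thesis
    using sym by simp
qed

text \<open>Morally \<open>D (V v) T = (a / f) V v\<close>. In the pairing it is enough to write it
  as \<open>V w\<close> and to know \<open>a * h v u = f * h w u\<close>.\<close>

lemma DV_T_DV_T:
  assumes "q \<in> I \<times> U"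
  shows "B q (D (V u) T q) (D (V v) T q) = a\<^sup>2 * h u v (snd q)"
proof -
  have p: "snd q \<in> U" and f: "f (fst q) > 0"
    using assms f_pos by auto
  have t: "D (V v) T q \<in> tangent_space P q" for v
    by (intro D_tangent E_field assms)
  obtain s w where w: "D (V v) T q = E (s, w) q"
    using tangent_cases[OF assms t] by blast
  \<comment> \<open>Pairing with \<open>T\<close> reads off \<open>- s\<close>.\<close>
  have s: "s = 0"
    using DE_T_T[OF assms, of "(0, v)"] h_zero_right[OF p] unfolding w by (simp add: B_E[OF assms])
  have "a * f (fst q) * h v u (snd q) = (f (fst q))\<^sup>2 * h w u (snd q)"
    using DV_T_V[OF assms, of v u] unfolding w s by (simp add: B_E[OF assms])
  then have "a * h v u (snd q) = f (fst q) * h w u (snd q)"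
    using f by (simp add: power2_eq_square)
  moreover have "B q (D (V u) T q) (D (V v) T q) = a * (f (fst q) * h w u (snd q))"
    using DV_T_V[OF assms, of u w] h_sym[OF p, of u w] unfolding w s by simp
  ultimately show ?thesis
    using h_sym[OF p, of u v] by (simp add: power2_eq_square)
qed

text \<open>\<open>k\<close> may be any number with this property at \<open>q\<close>. Pairing the
  curvature identity with \<open>V v\<close> leaves only the term containing
  \<open>k\<close>.\<close>

lemma curvature_factor_zero:
  assumes "q \<in> I \<times> U"
    and curv: "\<And>u. curvature P D T (V u) T q =
      (\<lambda>\<phi>. k * (B q (T q) (T q) * V u q \<phi> - B q (V u q) (T q) * T q \<phi>))"
  shows "k = 0"
proof -
  have p: "snd q \<in> U" and f: "f (fst q) > 0"
    using assms f_pos by auto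
  obtain u v where uv: "h u v (snd q) \<noteq> 0"
    using metric_coord_nonzero[OF metric chart p] unfolding h_def by blast
  have DVT: "vector_field P (I \<times> U) (D (V u) T)"
    and DTT: "vector_field P (I \<times> U) (D T T)"
    by (intro D_field E_field)+
  have "D (lie_bracket P T (V u)) T q = vzero"
    by (rule product.connection_zero[OF conn open_chart lie_bracket_E E_field assms(1)])
  moreover have "B q (T q) (T q) = - 1" "B q (V u q) (T q) = 0"
    using h_zero_left[OF p] h_zero_right[OF p] by (auto simp: B_E[OF assms(1)])
  \<comment> \<open>With this sign convention the right side of the curvature identity is
    \<open>- k V u\<close>; it is rearranged into the shape that \<open>B_linear\<close>
    accepts.\<close>
  ultimately have "D (V u) (D T T) q = vadd (vscale 1 (D T (D (V u) T) q)) (vscale (- k) (V u q))"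
    using curv[of u] by (simp add: curvature_def vadd_def vscale_def vzero_def fun_eq_iff) (simp add: algebra_simps)
  then have *: "B q (D (V u) (D T T) q) (V v q) =
      1 * B q (D T (D (V u) T) q) (V v q) + (- k) * B q (V u q) (V v q)"
    using B_linear[OF assms(1) D_tangent[OF E_field DVT assms(1)] E_tangent[OF assms(1)] E_tangent[OF assms(1)]]
    by simp
  have "V u q (\<lambda>q. B q (D T T q) (V v q)) = 0"
    by (rule E_const[OF assms(1) DT_T_zero[OF _ E_tangent]])
  then have 1: "B q (D (V u) (D T T) q) (V v q) = 0"
    using D_metric[OF assms(1) E_field DTT E_field, of "(0, u)" "(0, v)"]
      DT_T_zero[OF assms(1) D_tangent[OF E_field E_field assms(1)]] by simp
  \<comment> \<open>On \<open>I\<close> the factor \<open>a f\<close> is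
    \<open>a\<^sup>2 t + a b\<close>, of slope \<open>a\<^sup>2\<close>. This cancels against
    \<open>DV_T_DV_T\<close>, because \<open>D T (V v) = D (V v) T\<close>.\<close>
  have "T q (\<lambda>q. B q (D (V u) T q) (V v q)) = a\<^sup>2 * h u v (snd q)"
  proof (rule T_deriv[OF assms(1)])
    show "B q (D (V u) T q) (V v q) = (a\<^sup>2 * fst q + a * b) * h u v (snd q)" if "q \<in> I \<times> U" for q
      using that f_affine[of "fst q"] by (auto simp: DV_T_V power2_eq_square algebra_simps)
    show "smooth_on I (\<lambda>t. a\<^sup>2 * t + a * b)"
      by (rule smooth_affine)
    show "((\<lambda>t. a\<^sup>2 * t + a * b) has_field_derivative a\<^sup>2) (at (fst q))"
      by (auto intro!: derivative_eq_intros)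
  qed
  then have 2: "B q (D T (D (V u) T) q) (V v q) = 0"
    using D_metric[OF assms(1) E_field DVT E_field, of "(1, 0)" "(0, v)"]
      DV_T_DV_T[OF assms(1), of u v] D_commute[OF assms(1), of "(1, 0)" "(0, v)"] by simp
  have "k * ((f (fst q))\<^sup>2 * h u v (snd q)) = 0"
    using * 1 2 by (simp add: B_E[OF assms(1)])
  then show ?thesis
    using uv f by simp
qed

end

theorem proposition8:
  fixes M :: "('m, 'e::euclidean_space) manifold"
    and g :: "'m \<Rightarrow> 'm tvec \<Rightarrow> 'm tvec \<Rightarrow> real"
    and I :: "real set"
    and f h :: "real \<Rightarrow> real"
    and X :: "'m vfield"
    and Xbar :: "(real \<times> 'm) vfield"
    and n :: nat
  assumes "n = DIM('e)" and "n + 1 \<ge> 3"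
    and "smooth_manifold M" and "pseudo_riemannian_metric M g"
    and "open I" and "connected I"
    and "smooth_on I f" and "\<forall>t\<in>I. f t > 0"
    and "concircularly_flat (product_manifold I M) (grw_metric M f g)"
    and "vector_field M (carrier_of M) X" and "smooth_on I h"
    and "vector_field (product_manifold I M) (carrier_of (product_manifold I M)) Xbar"
    and "\<forall>(t, p)\<in>carrier_of (product_manifold I M).
           Xbar (t, p) = vadd (vscale (h t) (partial_t I M (t, p))) (lift_field I M X (t, p))"
    and "((\<exists>\<zeta>. concircular_field M g \<zeta>) \<and> (\<exists>k. \<forall>t\<in>I. f t = k))
         \<or> (\<exists>a b. \<forall>t\<in>I. f t = a * t + b)"
  shows "flat (product_manifold I M) (grw_metric M f g)"
proof -
  let ?P = "product_manifold I M" and ?B = "grw_metric M f g"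
  have "\<exists>a b. \<forall>t\<in>I. f t = a * t + b"
    using assms(14)
  proof
    assume "(\<exists>\<zeta>. concircular_field M g \<zeta>) \<and> (\<exists>k. \<forall>t\<in>I. f t = k)"
    then obtain k where "\<forall>t\<in>I. f t = k"
      by blast
    then have "\<forall>t\<in>I. f t = 0 * t + k"
      by simp
    then show ?thesis
      by blast
  qed
  then obtain a b where f: "\<And>t. t \<in> I \<Longrightarrow> f t = a * t + b"
    by blast
  interpret smooth_atlas M
    by (rule smooth_manifold_imp_smooth_atlas[OF assms(3)])
  obtain D where D: "levi_civita ?P ?B D"
    and conc: "\<And>W X Y Z q. openin (mtop ?P) W \<Longrightarrow> vector_field ?P W X \<Longrightarrow> vector_field ?P W Y \<Longrightarrow>
      vector_field ?P W Z \<Longrightarrow> q \<in> W \<Longrightarrow> concircular_curvature ?P ?B D X Y Z q = vzero"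
    using assms(9) unfolding concircularly_flat_def by metis
  \<comment> \<open>This factor depends on the point alone and is common to all arguments of the
    curvature.\<close>
  define k where "k q = scalar_curvature ?P ?B D q / (real DIM(real \<times> 'e) * (real DIM(real \<times> 'e) - 1))" for q
  have curv: "curvature ?P D X Y Z q =
      (\<lambda>\<phi>. k q * (?B q (X q) (Z q) * Y q \<phi> - ?B q (Y q) (Z q) * X q \<phi>))"
    if "openin (mtop ?P) W" "vector_field ?P W X" "vector_field ?P W Y" "vector_field ?P W Z" "q \<in> W"
    for W X Y Z q
    using fun_cong[OF conc[OF that]] by (auto simp: concircular_curvature_def k_def vzero_def)
  have k: "k q = 0" if q: "q \<in> carrier_of ?P" for q
  proof -
    have "snd q \<in> carrier_of M"
      using q by (auto simp: carrier_product)
    then obtain U c where U: "(U, c) \<in> atlas M" "snd q \<in> U"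
      using chart_exists by blast
    \<comment> \<open>The connection supplied by concircular flatness is used around every point and
      also witnesses \<open>flat\<close> at the end.\<close>
    interpret grw_chart M I g f a b D U c
      by unfold_locales (use assms f D U in auto)
    have qU: "q \<in> I \<times> U"
      using q U by (auto simp: carrier_product)
    show ?thesis
      by (rule curvature_factor_zero[OF qU], unfold B_def) (rule curv[OF open_chart E_field E_field E_field qU])
  qed
  have "curvature ?P D X Y Z q = vzero"
    if "openin (mtop ?P) W" "vector_field ?P W X" "vector_field ?P W Y" "vector_field ?P W Z" "q \<in> W"
    for W X Y Z q
  proof -
    have "q \<in> carrier_of ?P"
      using that(1,5) openin_subset by blast
    then show ?thesis
      using curv[OF that] k by (simp add: vzero_def)
  qed
  with D show ?thesis
    unfolding flat_def by blast
qed

end
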